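(* Let $1\le m\le n-1$ be integers and let $\mu$ be a Radon measure on $\mathbb{R}^n$. (1) At $\mu$-a.e. $x\in\mathbb{R}^n$ such that $G_{\mu,X}(x)<\infty$ for some bad cone $X$, we have $$\underline{D}^m(\mu,x)=\liminf_{r\downarrow 0}\frac{\mu(B(x,r))}{r^m}>0.$$ (2) At $\mu$-a.e. $x\in\mathbb{R}^n$ such that $\underline{D}^m(\mu,x)=0$, we have $G_{\mu,X}(x)=\infty$ for every bad cone $X$.
   Context: Fix integers $1\le m\le n-1$. $G(n,m)$ is the set of $m$-dimensional linear subspaces of $\mathbb{R}^n$ and $V^\perp$ is the orthogonal complement of $V$. $B(x,r)$ and $U(x,r)$ denote closed and open Euclidean balls. A Radon measure on $\mathbb{R}^n$ is a Borel regular outer measure that is finite on compact sets. Bad cones. A bad cone is a set $X=X(V,\alpha)=\{x\in\mathbb{R}^n:\operatorname{dist}(x,V)>\alpha\operatorname{dist}(x,V^\perp)\}$ with $V\in G(n,m)$ and $\alpha\in(0,\infty)$. Write $X_x=x+X$ and $X_Q=\bigcup_{x\in Q}X_x$ for nonempty $Q\subseteq\mathbb{R}^n$. Dyadic cubes. A dyadic cube is a half-open cube $Q=\prod_{i=1}^n[j_i2^{-k},(j_i+1)2^{-k})$ with $k,j_1,\dots,j_n\in\mathbb{Z}$; $\operatorname{side}Q=2^{-k}$ and $x_Q$ is the center of $Q$. Conical defect. For a dyadic cube $Q$ and bad cone $X=X(V,\alpha)$, put $r_{Q,X}=81\sqrt{n}\max(\alpha,1/\alpha)\operatorname{side}Q$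 and $A_{Q,X}=X_Q\cap B(x_Q,r_{Q,X})\setminus U(x_Q,r_{Q,X}/3)$. Let $\Delta^*_{Q,X}$ be the set of all dyadic cubes $R$ with $\operatorname{side}R=\operatorname{side}Q$ and $R\cap A_{Q,X}\ne\emptyset$. For a Radon measure $\mu$, set $\mathrm{Defect}(\mu,Q,X)=\sum_{R\in\Delta^*_{Q,X}}\mu(R)/\mu(Q)$ if $\mu(Q)>0$, and $\mathrm{Defect}(\mu,Q,X)=0$ if $\mu(Q)=0$. Conical Dini function. $G_{\mu,X}:\mathbb{R}^n\to[0,\infty]$ is $G_{\mu,X}(x)=\sum_{\operatorname{side}Q\le1}\mathrm{Defect}(\mu,Q,X)\,\chi_Q(x)$, the sum over all dyadic cubes $Q$ of side length at most $1$. *)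

theory Defs
  imports "HOL-Analysis.Analysis"
begin

text \<open>
  Measures are outer measures defined on all subsets; \<^const>\<open>lambda_system\<close> is the family of
  Caratheodory measurable sets. Together with monotonicity, the countable subadditivity in
  \<^const>\<open>outer_measure_space\<close>, which mentions disjoint sequences only, extends to all sequences.
\<close>

definition borel_regular :: "('a::topological_space set \<Rightarrow> ennreal) \<Rightarrow> bool" where
  "borel_regular \<mu> \<longleftrightarrow>
     sets borel \<subseteq> lambda_system UNIV UNIV \<mu> \<and>
     (\<forall>A. \<exists>B\<in>sets borel. A \<subseteq> B \<and> \<mu> B = \<mu> A)"

definition radon_measure :: "('a::topological_space set \<Rightarrow> ennreal) \<Rightarrow> bool" where
  "radon_measure \<mu> \<longleftrightarrow>
     outer_measure_space UNIV \<mu> \<and> borel_regular \<mu> \<and> (\<forall>K. compact K \<longrightarrow> \<mu> K < \<infinity>)"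

definition outer_AE :: "('a set \<Rightarrow> ennreal) \<Rightarrow> ('a \<Rightarrow> bool) \<Rightarrow> bool" where
  "outer_AE \<mu> P \<longleftrightarrow> \<mu> {x. \<not> P x} = 0"

definition lower_density :: "nat \<Rightarrow> ('a::metric_space set \<Rightarrow> ennreal) \<Rightarrow> 'a \<Rightarrow> ennreal" where
  "lower_density m \<mu> x = Liminf (at_right 0) (\<lambda>r. \<mu> (cball x r) / ennreal (r ^ m))"

definition grassmannian :: "nat \<Rightarrow> 'a::euclidean_space set set" where
  "grassmannian m = {V. subspace V \<and> dim V = m}"

definition bad_cone :: "'a::euclidean_space set \<Rightarrow> real \<Rightarrow> 'a set" where
  "bad_cone V \<alpha> = {x. infdist x V > \<alpha> * infdist x (V\<^sup>\<bottom>)}"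

definition cone_at :: "'a::euclidean_space set \<Rightarrow> 'a set \<Rightarrow> 'a set" where
  "cone_at X Q = (\<Union>x\<in>Q. (+) x ` X)"

definition dyadic_cube :: "int \<Rightarrow> ('n::finite \<Rightarrow> int) \<Rightarrow> (real ^ 'n) set" where
  "dyadic_cube k j =
     {x. \<forall>i. of_int (j i) * 2 powi (- k) \<le> x $ i \<and> x $ i < (of_int (j i) + 1) * 2 powi (- k)}"

definition dyadic_cubes :: "(real ^ 'n::finite) set set" where
  "dyadic_cubes = {dyadic_cube k j |k j. True}"

text \<open>
  The side length and the center are functions of the cube as a set; the lemmas
  \<open>side_dyadic_cube\<close> and \<open>center_dyadic_cube\<close> show that they are well defined.
\<close>

definition side :: "(real ^ 'n::finite) set \<Rightarrow> real" where
  "side Q = (THE s. \<exists>k j. Q = dyadic_cube k j \<and> s = 2 powi (- k))"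

definition center :: "(real ^ 'n::finite) set \<Rightarrow> real ^ 'n" where
  "center Q = (THE c. \<exists>k j. Q = dyadic_cube k j \<and> c = (\<chi> i. (of_int (j i) + 1 / 2) * 2 powi (- k)))"

lemma half_open_cube_eqD:
  fixes a b :: "'n::finite \<Rightarrow> real"
  assumes eq: "{x :: real ^ 'n. \<forall>i. a i \<le> x $ i \<and> x $ i < a i + s} =
               {x. \<forall>i. b i \<le> x $ i \<and> x $ i < b i + t}"
    and s: "s > 0" and t: "t > 0"
  shows "a = b \<and> s = t"
proof -
  have P: "(\<forall>i. a i \<le> x i \<and> x i < a i + s) \<longleftrightarrow> (\<forall>i. b i \<le> x i \<and> x i < b i + t)" for x
    using arg_cong[OF eq, of "\<lambda>S. (\<chi> i. x i) \<in> S"] by simp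
  have ab: "a = b"
  proof
    fix i
    show "a i = b i"
      using P[of a] P[of b] s t by (auto intro: antisym)
  qed
  have "\<not> s < t" using P[of "\<lambda>i. a i + s"] ab s by auto
  moreover have "\<not> t < s" using P[of "\<lambda>i. a i + t"] ab t by auto
  ultimately show ?thesis using ab by auto
qed

lemma dyadic_cube_inject:
  fixes j j' :: "'n::finite \<Rightarrow> int"
  shows "dyadic_cube k j = dyadic_cube k' j' \<longleftrightarrow> k = k' \<and> j = j'"
proof
  assume eq: "dyadic_cube k j = dyadic_cube k' j'"
  have "(\<lambda>i. of_int (j i) * 2 powi (- k)) = (\<lambda>i. of_int (j' i) * 2 powi (- k') :: real) \<and>
        (2 powi (- k) :: real) = 2 powi (- k')"
    by (rule half_open_cube_eqD)
       (use eq in \<open>simp_all add: dyadic_cube_def algebra_simps\<close>)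
  then have *: "(\<lambda>i. of_int (j i) * 2 powi (- k)) = (\<lambda>i. of_int (j' i) * 2 powi (- k') :: real)"
    and **: "(2 powi (- k) :: real) = 2 powi (- k')" by auto
  have k: "k = k'"
    using ** power_int_strict_increasing[of "- k" "- k'" "2 :: real"]
      power_int_strict_increasing[of "- k'" "- k" "2 :: real"]
    by (cases k k' rule: linorder_cases) auto
  moreover have "j = j'"
  proof
    fix i show "j i = j' i" using fun_cong[OF *, of i] k by simp
  qed
  ultimately show "k = k' \<and> j = j'" by simp
qed simp

lemma side_dyadic_cube: "side (dyadic_cube k j) = 2 powi (- k)"
  unfolding side_def dyadic_cube_inject by (rule the_equality) auto

lemma center_dyadic_cube:
  "center (dyadic_cube k j) = (\<chi> i. (of_int (j i) + 1 / 2) * 2 powi (- k))"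
  unfolding center_def dyadic_cube_inject by (rule the_equality) auto

text \<open>
  The notions below depend on the cone X(V, \<open>\<alpha>\<close>) also through its opening \<open>\<alpha>\<close>, so they take
  V and \<open>\<alpha>\<close> as parameters in place of X.
\<close>

definition cone_radius :: "real \<Rightarrow> (real ^ 'n::finite) set \<Rightarrow> real" where
  "cone_radius \<alpha> Q = 81 * sqrt (real CARD('n)) * max \<alpha> (1 / \<alpha>) * side Q"

definition cone_annulus :: "(real ^ 'n::finite) set \<Rightarrow> real \<Rightarrow> (real ^ 'n) set \<Rightarrow> (real ^ 'n) set" where
  "cone_annulus V \<alpha> Q =
     cone_at (bad_cone V \<alpha>) Q \<inter> cball (center Q) (cone_radius \<alpha> Q) -
     ball (center Q) (cone_radius \<alpha> Q / 3)"

definition annulus_cubes ::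
    "(real ^ 'n::finite) set \<Rightarrow> real \<Rightarrow> (real ^ 'n) set \<Rightarrow> (real ^ 'n) set set" where
  "annulus_cubes V \<alpha> Q =
     {R \<in> dyadic_cubes. side R = side Q \<and> R \<inter> cone_annulus V \<alpha> Q \<noteq> {}}"

definition defect ::
    "((real ^ 'n::finite) set \<Rightarrow> ennreal) \<Rightarrow> (real ^ 'n) set \<Rightarrow> (real ^ 'n) set \<Rightarrow> real \<Rightarrow> ennreal" where
  "defect \<mu> Q V \<alpha> =
     (if \<mu> Q > 0 then (\<Sum>\<^sub>\<infinity>R\<in>annulus_cubes V \<alpha> Q. \<mu> R / \<mu> Q) else 0)"

definition conical_dini ::
    "((real ^ 'n::finite) set \<Rightarrow> ennreal) \<Rightarrow> (real ^ 'n) set \<Rightarrow> real \<Rightarrow> real ^ 'n \<Rightarrow> ennreal" where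
  "conical_dini \<mu> V \<alpha> x =
     (\<Sum>\<^sub>\<infinity>Q\<in>{Q \<in> dyadic_cubes. side Q \<le> 1}. defect \<mu> Q V \<alpha> * indicator Q x)"

end

theory Submission
  imports Defs
begin

text \<open>
  Both parts say that the points with lower density 0 at which some conical Dini function is
  finite form a \<open>\<mu>\<close>-null set.

  The family of bad cones is uncountable, but the cubes in the annulus of a dyadic cube are its
  translates by a finite set of grid vectors that is the same for all cubes. The Dini function
  depends on the cone only through this finite set (\<open>conical_dini_cong\<close>), so countably many Dini
  functions occur, and one cone \<open>X(V, \<alpha>)\<close> can be treated at a time.

  Let \<open>F\<close> be the set of points of a unit cube at which the Dini function is at most \<open>N\<close>, in the
  sense of partial sums. Discarding from \<open>F\<close> the maximal cubes in which \<open>F\<close> has proportion at most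
  \<open>1 / c\<close> loses measure at most a constant over \<open>c\<close> (\<open>measure_invisible_points\<close>). For a cube \<open>Q\<close>
  around a remaining point, the mass of the annulus cubes of \<open>Q\<close> is the defect times \<open>\<mu> Q\<close>, hence
  at most \<open>c\<close> times the integral of the defect over \<open>F \<inter> Q\<close>. The sum over all such cubes is at
  most \<open>c * N * \<mu> F\<close> (\<open>sum_measure_annulus_trace_le\<close>). By Borel-Cantelli almost every remaining
  point lies in annulus cubes of only finitely many generations.

  Every point of the cone at \<open>y\<close> near \<open>y\<close> lies in the annulus of a small cube containing \<open>y\<close>
  (\<open>cone_point_in_some_annulus\<close>). So the remaining points split, up to a null set, into countably
  many pieces in which no point lies in the cone at another. Such a piece is a Lipschitz graph
  over the \<open>m\<close>-dimensional space \<open>V\<close>, and a Vitali covering of its projection by balls of small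
  \<open>m\<close>-density shows that the points of lower density 0 in it are null
  (\<open>lower_density_zero_null_on_graph\<close>).
\<close>

section \<open>Radon outer measures and the Borel sets\<close>

lemma outer_measure_mono:
  assumes "outer_measure_space UNIV \<mu>" "A \<subseteq> B"
  shows "\<mu> A \<le> \<mu> B"
  using assms by (auto simp: outer_measure_space_def increasing_def)

lemma outer_measure_empty:
  assumes "outer_measure_space UNIV \<mu>"
  shows "\<mu> {} = 0"
  using assms by (auto simp: outer_measure_space_def positive_def)

lemma outer_measure_UN_le:
  fixes A :: "nat \<Rightarrow> 'a set"
  assumes "outer_measure_space UNIV \<mu>"
  shows "\<mu> (\<Union>n. A n) \<le> (\<Sum>n. \<mu> (A n))"
proof -
  have "\<mu> (\<Union>n. A n) = \<mu> (\<Union>n. disjointed A n)"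
    by (simp add: UN_disjointed_eq)
  also have "\<dots> \<le> (\<Sum>n. \<mu> (disjointed A n))"
    using assms disjoint_family_disjointed[of A]
    by (auto simp: outer_measure_space_def countably_subadditive_def)
  also have "\<dots> \<le> (\<Sum>n. \<mu> (A n))"
    by (intro suminf_le outer_measure_mono[OF assms] disjointed_subset) auto
  finally show ?thesis .
qed

lemma outer_measure_Un_le:
  assumes "outer_measure_space UNIV \<mu>"
  shows "\<mu> (A \<union> B) \<le> \<mu> A + \<mu> B"
proof -
  have "\<mu> (\<Union>n. binaryset A B n) \<le> (\<Sum>n. \<mu> (binaryset A B n))"
    by (rule outer_measure_UN_le[OF assms])
  also have "\<dots> = \<mu> A + \<mu> B"
    by (rule suminf_binaryset_eq[of \<mu>]) (rule outer_measure_empty[OF assms])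
  finally show ?thesis by (simp add: UN_binaryset_eq)
qed

lemma outer_measure_finite_UN_le:
  assumes "outer_measure_space UNIV \<mu>" "finite I"
  shows "\<mu> (\<Union>i\<in>I. A i) \<le> (\<Sum>i\<in>I. \<mu> (A i))"
  using assms(2)
proof (induction I rule: finite_induct)
  case empty
  show ?case by (simp add: outer_measure_empty[OF assms(1)])
next
  case (insert i I)
  have "\<mu> (\<Union>i\<in>insert i I. A i) \<le> \<mu> (A i) + \<mu> (\<Union>i\<in>I. A i)"
    using outer_measure_Un_le[OF assms(1)] by simp
  also have "\<dots> \<le> \<mu> (A i) + (\<Sum>i\<in>I. \<mu> (A i))"
    by (intro add_left_mono insert.IH)
  finally show ?case using insert.hyps by simp
qed

lemma outer_null_countable_UN:
  assumes "outer_measure_space UNIV \<mu>" "countable I" "\<And>i. i \<in> I \<Longrightarrow> \<mu> (A i) = 0"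
  shows "\<mu> (\<Union>i\<in>I. A i) = 0"
proof (cases "I = {}")
  case True
  then show ?thesis by (simp add: outer_measure_empty[OF assms(1)])
next
  case False
  then have "(\<Union>i\<in>I. A i) = (\<Union>n. A (from_nat_into I n))"
    using range_from_nat_into[OF False assms(2)] by (metis image_image)
  moreover have "\<mu> (A (from_nat_into I n)) = 0" for n
    using assms(3) from_nat_into[OF False] by blast
  ultimately show ?thesis
    using outer_measure_UN_le[OF assms(1), of "\<lambda>n. A (from_nat_into I n)"] by simp
qed

lemma outer_null_subset:
  assumes "outer_measure_space UNIV \<mu>" "A \<subseteq> B" "\<mu> B = 0"
  shows "\<mu> A = 0"
  using outer_measure_mono[OF assms(1,2)] assms(3) by simp

text \<open>
  How every covering argument below ends: the outer measure of a union is controlled by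
  comparing each covering set with a member of a disjoint family of measurable sets.
\<close>

lemma outer_measure_UN_le_emeasure_UN:
  fixes \<mu> :: "'a set \<Rightarrow> ennreal" and N :: "'c measure" and A :: "'b \<Rightarrow> 'a set"
  assumes om: "outer_measure_space UNIV \<mu>" and "countable I"
    and disj: "disjoint_family_on B I" and B: "\<And>i. i \<in> I \<Longrightarrow> B i \<in> sets N"
    and le: "\<And>i. i \<in> I \<Longrightarrow> \<mu> (A i) \<le> emeasure N (B i)"
  shows "\<mu> (\<Union>i\<in>I. A i) \<le> emeasure N (\<Union>i\<in>I. B i)"
proof -
  \<comment> \<open>enumerate \<open>I\<close> injectively and pad with empty sets, since \<open>I\<close> may be finite\<close>
  define J where "J = to_nat_on I ` I"
  define pad where "pad = (\<lambda>S :: 'b \<Rightarrow> 'a set. \<lambda>n. if n \<in> J then S (from_nat_into I n) else {})"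
  define pad' where "pad' = (\<lambda>S :: 'b \<Rightarrow> 'c set. \<lambda>n. if n \<in> J then S (from_nat_into I n) else {})"
  have mem: "from_nat_into I n \<in> I" if "n \<in> J" for n
    using that \<open>countable I\<close> by (auto simp: J_def)
  have inj: "n = n'" if "n \<in> J" "n' \<in> J" "from_nat_into I n = from_nat_into I n'" for n n'
    using that \<open>countable I\<close> by (auto simp: J_def)
  have surj: "\<exists>n\<in>J. from_nat_into I n = i" if "i \<in> I" for i
    using that \<open>countable I\<close> by (auto simp: J_def)
  have "(\<Union>i\<in>I. A i) = (\<Union>n. pad A n)"
    using mem surj by (fastforce simp: pad_def split: if_splits)
  then have "\<mu> (\<Union>i\<in>I. A i) \<le> (\<Sum>n. \<mu> (pad A n))"
    using outer_measure_UN_le[OF om, of "pad A"] by simp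
  also have "\<dots> \<le> (\<Sum>n. emeasure N (pad' B n))"
    using le mem by (intro suminf_le) (auto simp: pad_def pad'_def outer_measure_empty[OF om])
  also have "\<dots> = emeasure N (\<Union>n. pad' B n)"
  proof (rule suminf_emeasure)
    show "range (pad' B) \<subseteq> sets N" using B mem by (auto simp: pad'_def)
    show "disjoint_family (pad' B)"
      using disj mem inj unfolding disjoint_family_on_def pad'_def by (auto split: if_splits) blast+
  qed
  also have "(\<Union>n. pad' B n) = (\<Union>i\<in>I. B i)"
    using mem surj by (fastforce simp: pad'_def split: if_splits)
  finally show ?thesis .
qed

text \<open>The Borel sets are Caratheodory measurable, so integration theory applies to this measure.\<close>

definition borel_restriction :: "('a::topological_space set \<Rightarrow> ennreal) \<Rightarrow> 'a measure" where
  "borel_restriction \<mu> = measure_of UNIV (sets borel) \<mu>"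

lemma sets_borel_restriction [simp, measurable_cong]: "sets (borel_restriction \<mu>) = sets borel"
  unfolding borel_restriction_def by (metis sets.sigma_sets_eq sets_measure_of space_borel top_greatest Pow_UNIV)

lemma emeasure_borel_restriction:
  assumes "radon_measure \<mu>" "A \<in> sets borel"
  shows "emeasure (borel_restriction \<mu>) A = \<mu> A"
proof -
  have om: "outer_measure_space UNIV \<mu>" and sub: "sets borel \<subseteq> lambda_system UNIV UNIV \<mu>"
    using assms(1) by (auto simp: radon_measure_def borel_regular_def)
  interpret sigma_algebra UNIV "UNIV :: 'a set set"
    using sigma_algebra_Pow[of UNIV] by simp
  have ms: "measure_space UNIV (lambda_system UNIV UNIV \<mu>) \<mu>"
    by (rule caratheodory_lemma[OF om])
  show ?thesis
    unfolding borel_restriction_def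
  proof (rule emeasure_measure_of_sigma)
    show "sigma_algebra UNIV (sets (borel :: 'a measure))"
      using sets.sigma_algebra_axioms[of "borel :: 'a measure"] by simp
    show "positive (sets borel) \<mu>" using ms by (simp add: measure_space_def positive_def)
    show "countably_additive (sets borel) \<mu>"
      using ms sub unfolding measure_space_def countably_additive_def
      by (meson subset_trans subsetD)
  qed (rule assms(2))
qed

lemma radon_measure_bounded_finite:
  fixes \<mu> :: "'a::heine_borel set \<Rightarrow> ennreal"
  assumes "radon_measure \<mu>" "bounded A"
  shows "\<mu> A < \<infinity>"
proof -
  have "\<mu> A \<le> \<mu> (closure A)"
    using assms(1) closure_subset by (auto simp: radon_measure_def intro: outer_measure_mono)
  also have "\<dots> < \<infinity>" using assms by (auto simp: radon_measure_def)
  finally show ?thesis .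
qed

section \<open>Vanishing lower density on Lipschitz pieces\<close>

text \<open>
  The bound 1 on the radius will keep the disjoint projected balls inside one bounded set.
\<close>

lemma lower_density_zeroD:
  assumes "lower_density m \<mu> x = 0" "0 < \<epsilon>"
  shows "\<exists>r. 0 < r \<and> r < 1 \<and> \<mu> (cball x r) \<le> ennreal (\<epsilon> * r ^ m)"
proof (rule ccontr)
  assume none: "\<nexists>r. 0 < r \<and> r < 1 \<and> \<mu> (cball x r) \<le> ennreal (\<epsilon> * r ^ m)"
  have "ennreal \<epsilon> \<le> \<mu> (cball x r) / ennreal (r ^ m)" if r: "0 < r" "r < 1" for r
  proof -
    have "ennreal \<epsilon> = ennreal (\<epsilon> * r ^ m) / ennreal (r ^ m)"
      using r assms(2) by (simp add: divide_ennreal)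
    also have "\<dots> \<le> \<mu> (cball x r) / ennreal (r ^ m)"
      using none r by (intro divide_right_mono_ennreal) (meson nle_le)
    finally show ?thesis .
  qed
  then have "\<forall>\<^sub>F r in at_right 0. ennreal \<epsilon> \<le> \<mu> (cball x r) / ennreal (r ^ m)"
    unfolding eventually_at_right_field by (intro exI[of _ 1]) auto
  then have "ennreal \<epsilon> \<le> lower_density m \<mu> x"
    unfolding lower_density_def by (rule Liminf_bounded)
  then show False using assms by simp
qed

lemma norm_vec_le_sqrt_CARD:
  fixes x :: "real ^ 'n::finite"
  assumes "\<And>i. \<bar>x $ i\<bar> \<le> c"
  shows "norm x \<le> sqrt (real CARD('n)) * c"
proof -
  have "c \<ge> 0" using assms[of undefined] abs_ge_zero order_trans by blast
  have "(\<Sum>i\<in>UNIV. (x $ i)\<^sup>2) \<le> (\<Sum>i\<in>(UNIV :: 'n set). c\<^sup>2)"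
    using assms \<open>c \<ge> 0\<close> by (intro sum_mono) (simp add: abs_le_square_iff[symmetric])
  then have "norm x \<le> sqrt (real CARD('n) * c\<^sup>2)"
    unfolding norm_vec_def L2_set_def by simp
  then show ?thesis using \<open>c \<ge> 0\<close> by (simp add: real_sqrt_mult)
qed

text \<open>
  A box of side proportional to \<open>\<rho>\<close> in the \<open>m\<close> directions of \<open>I\<close> and of side 2 in the others
  has \<open>n\<close>-dimensional volume proportional to \<open>\<rho> ^ m\<close>, where \<open>m\<close> is the cardinality of \<open>I\<close>. Such
  boxes reduce \<open>m\<close>-dimensional volume comparisons to Lebesgue measure of the ambient space.
\<close>

definition thick_box :: "'n::finite set \<Rightarrow> real ^ 'n \<Rightarrow> real \<Rightarrow> (real ^ 'n) set" where
  "thick_box I c \<rho> = cbox (\<chi> i. if i \<in> I then c $ i - \<rho> / sqrt (real CARD('n)) else -1)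
                          (\<chi> i. if i \<in> I then c $ i + \<rho> / sqrt (real CARD('n)) else 1)"

lemma emeasure_thick_box:
  fixes c :: "real ^ 'n::finite"
  assumes "0 \<le> \<rho>"
  shows "emeasure lborel (thick_box I c \<rho>) =
    ennreal ((2 * \<rho> / sqrt (real CARD('n))) ^ card I * 2 ^ card (- I))"
proof -
  let ?t = "\<rho> / sqrt (real CARD('n))"
  let ?a = "\<chi> i. if i \<in> I then c $ i - ?t else -1"
  let ?b = "\<chi> i. if i \<in> I then c $ i + ?t else 1"
  have t: "?t \<ge> 0" using assms by simp
  have ne: "cbox ?a ?b \<noteq> {}"
    unfolding interval_ne_empty_cart using t by auto
  have "measure lborel (cbox ?a ?b) = (\<Prod>i\<in>UNIV. ?b $ i - ?a $ i)"
    using ne by (rule content_cbox_cart)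
  also have "\<dots> = (\<Prod>i\<in>UNIV. if i \<in> I then 2 * ?t else 2)"
    by (intro prod.cong) auto
  also have "\<dots> = (2 * ?t) ^ card I * 2 ^ card (- I)"
    by (simp add: prod.If_cases Compl_eq)
  finally have "measure lborel (thick_box I c \<rho>) = (2 * ?t) ^ card I * 2 ^ card (- I)"
    by (simp add: thick_box_def)
  moreover have "emeasure lborel (thick_box I c \<rho>) \<noteq> \<infinity>"
    unfolding thick_box_def using emeasure_lborel_cbox_finite[of ?a ?b] by simp
  ultimately show ?thesis
    by (simp add: emeasure_eq_ennreal_measure mult.commute)
qed

text \<open>
  A common point of two boxes projects into both balls, because a cube of half side
  \<open>\<rho> / sqrt n\<close> is contained in the ball of radius \<open>\<rho>\<close>.
\<close>

lemma thick_box_disjoint: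
  fixes c d :: "real ^ 'n::finite"
  assumes "\<And>i. i \<notin> I \<Longrightarrow> c $ i = 0" "\<And>i. i \<notin> I \<Longrightarrow> d $ i = 0"
    and "cball c \<rho> \<inter> cball d \<sigma> = {}" "0 \<le> \<rho>" "0 \<le> \<sigma>"
  shows "thick_box I c \<rho> \<inter> thick_box I d \<sigma> = {}"
proof -
  let ?p = "\<lambda>z :: real ^ 'n. \<chi> i. if i \<in> I then z $ i else 0"
  have *: "?p z \<in> cball e \<tau>"
    if "z \<in> thick_box I e \<tau>" "\<And>i. i \<notin> I \<Longrightarrow> e $ i = 0" "0 \<le> \<tau>" for z e \<tau>
  proof -
    have "\<bar>(e - ?p z) $ i\<bar> \<le> \<tau> / sqrt (real CARD('n))" for i
    proof (cases "i \<in> I")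
      case True
      have "e $ i - \<tau> / sqrt (real CARD('n)) \<le> z $ i \<and> z $ i \<le> e $ i + \<tau> / sqrt (real CARD('n))"
        using that(1) True unfolding thick_box_def mem_box_cart by (auto dest!: spec[of _ i])
      then show ?thesis using True by (simp add: abs_le_iff)
    qed (use that in auto)
    from norm_vec_le_sqrt_CARD[OF this] show ?thesis by (simp add: dist_norm)
  qed
  show ?thesis using * [of _ c \<rho>] * [of _ d \<sigma>] assms by blast
qed

text \<open>
  Balls around points of \<open>P\<close> with \<open>\<mu>\<close>-mass at most \<open>\<epsilon>\<close> times the \<open>m\<close>-th power of the radius
  are projected by \<open>\<psi>\<close>; a Vitali subfamily of the projected balls is disjoint, so its
  \<open>m\<close>-dimensional volume is bounded, while the inverse Lipschitz bound makes the original
  balls cover. This bounds the outer measure by a constant times \<open>\<epsilon>\<close>.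
\<close>

lemma lower_density_zero_null_on_graph:
  fixes \<mu> :: "'a::metric_space set \<Rightarrow> ennreal" and \<psi> :: "'a \<Rightarrow> real ^ 'n::finite"
  assumes om: "outer_measure_space UNIV \<mu>"
    and zero: "\<And>x i. x \<in> P \<Longrightarrow> i \<notin> I \<Longrightarrow> \<psi> x $ i = 0"
    and bdd: "bounded (\<psi> ` P)"
    and lip: "\<And>x y. x \<in> P \<Longrightarrow> y \<in> P \<Longrightarrow> dist x y \<le> C * dist (\<psi> x) (\<psi> y)"
  shows "\<mu> {x \<in> P. lower_density (card I) \<mu> x = 0} = 0"
proof -
  define m where "m = card I"
  define Z where "Z = {x \<in> P. lower_density m \<mu> x = 0}"
  \<comment> \<open>\<open>C\<close> may be zero or negative when \<open>P\<close> has at most one point\<close>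
  define C' where "C' = max C 1"
  have lip': "dist x y \<le> C' * dist (\<psi> x) (\<psi> y)" if "x \<in> P" "y \<in> P" for x y
    using lip[OF that] mult_right_mono[of C C' "dist (\<psi> x) (\<psi> y)"] by (auto simp: C'_def)
  have C'1: "C' \<ge> 1" by (simp add: C'_def)
  obtain K where K: "\<And>x. x \<in> P \<Longrightarrow> norm (\<psi> x) \<le> K"
    using bdd by (auto simp: bounded_iff)
  define D where "D = cbox (\<chi> i. - (\<bar>K\<bar> + 1)) (\<chi> i :: 'n. \<bar>K\<bar> + 1)"
  \<comment> \<open>so that \<open>r ^ m = A * (\<rho> / sqrt n) ^ m\<close> for the radius \<open>\<rho> = r / (5 * C')\<close> used below\<close>
  define A where "A = (5 * C' * sqrt (real CARD('n))) ^ m"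
  have A: "A \<ge> 0" using C'1 by (simp add: A_def)
  have key: "\<mu> Z \<le> ennreal \<epsilon> * (ennreal A * emeasure lborel D)" if \<epsilon>: "\<epsilon> > 0" for \<epsilon>
  proof -
    have "\<forall>x\<in>Z. \<exists>r. 0 < r \<and> r < 1 \<and> \<mu> (cball x r) \<le> ennreal (\<epsilon> * r ^ m)"
      using lower_density_zeroD \<epsilon> unfolding Z_def by blast
    then obtain r where r: "\<And>x. x \<in> Z \<Longrightarrow> 0 < r x" "\<And>x. x \<in> Z \<Longrightarrow> r x < 1"
      "\<And>x. x \<in> Z \<Longrightarrow> \<mu> (cball x (r x)) \<le> ennreal (\<epsilon> * r x ^ m)"
      by metis
    \<comment> \<open>Vitali enlarges by 5 and going back along \<open>\<psi>\<close> by \<open>C'\<close>; this radius ends at \<open>r x\<close>\<close>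
    define \<rho> where "\<rho> x = r x / (5 * C')" for x
    have \<rho>: "0 < \<rho> x \<and> \<rho> x \<le> 1" if "x \<in> Z" for x
    proof -
      have "r x \<le> 5 * C'" using r(2)[OF that] C'1 by linarith
      then show ?thesis using r(1)[OF that] C'1 by (simp add: \<rho>_def field_simps)
    qed
    have "\<psi> ` Z \<subseteq> (\<Union>x\<in>Z. cball (\<psi> x) (\<rho> x))"
      using \<rho> by (force simp: less_imp_le)
    from Vitali_covering_lemma_cballs[OF this \<rho>]
    obtain J where J: "countable J" "J \<subseteq> Z"
      "pairwise (\<lambda>x y. disjnt (cball (\<psi> x) (\<rho> x)) (cball (\<psi> y) (\<rho> y))) J"
      "\<psi> ` Z \<subseteq> (\<Union>x\<in>J. cball (\<psi> x) (5 * \<rho> x))"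
      by blast
    have "Z \<subseteq> (\<Union>x\<in>J. cball x (r x))"
    proof
      fix y assume y: "y \<in> Z"
      then obtain x where x: "x \<in> J" "dist (\<psi> x) (\<psi> y) \<le> 5 * \<rho> x"
        using J(4) by (fastforce simp: subset_iff)
      then have "dist x y \<le> C' * (5 * \<rho> x)"
        using lip'[of x y] y J(2) C'1 by (smt (verit) Z_def mem_Collect_eq mult_left_mono subsetD)
      also have "\<dots> = r x" using C'1 by (simp add: \<rho>_def)
      finally show "y \<in> (\<Union>x\<in>J. cball x (r x))" using x by auto
    qed
    then have "\<mu> Z \<le> \<mu> (\<Union>x\<in>J. cball x (r x))"
      by (rule outer_measure_mono[OF om])
    also have "\<dots> \<le> emeasure (scale_measure (ennreal (\<epsilon> * A)) lborel) (\<Union>x\<in>J. thick_box I (\<psi> x) (\<rho> x))"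
    proof (rule outer_measure_UN_le_emeasure_UN[OF om J(1)])
      show "disjoint_family_on (\<lambda>x. thick_box I (\<psi> x) (\<rho> x)) J"
        unfolding disjoint_family_on_def
      proof (intro ballI impI)
        fix x y assume xy: "x \<in> J" "y \<in> J" "x \<noteq> y"
        then have "cball (\<psi> x) (\<rho> x) \<inter> cball (\<psi> y) (\<rho> y) = {}"
          using J(3) by (auto simp: pairwise_def disjnt_def)
        then show "thick_box I (\<psi> x) (\<rho> x) \<inter> thick_box I (\<psi> y) (\<rho> y) = {}"
          using xy J(2) \<rho>[of x] \<rho>[of y] by (intro thick_box_disjoint zero) (auto simp: Z_def)
      qed
      show "thick_box I (\<psi> x) (\<rho> x) \<in> sets (scale_measure (ennreal (\<epsilon> * A)) lborel)" for x
        by (simp add: thick_box_def)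
      fix x assume x: "x \<in> J"
      then have xZ: "x \<in> Z" using J(2) by auto
      have pos: "0 < \<rho> x" using \<rho>[OF xZ] by simp
      have "r x ^ m = A * (\<rho> x / sqrt (real CARD('n))) ^ m"
        using C'1 by (simp add: A_def \<rho>_def flip: power_mult_distrib)
      also have "\<dots> \<le> A * ((2 * \<rho> x / sqrt (real CARD('n))) ^ m * 2 ^ card (- I))"
      proof (rule mult_left_mono[OF _ A])
        have "(\<rho> x / sqrt (real CARD('n))) ^ m \<le> (2 * \<rho> x / sqrt (real CARD('n))) ^ m"
          using pos by (intro power_mono divide_right_mono) auto
        also have "\<dots> \<le> (2 * \<rho> x / sqrt (real CARD('n))) ^ m * 2 ^ card (- I)"
          using mult_left_mono[of 1 "2 ^ card (- I)" "(2 * \<rho> x / sqrt (real CARD('n))) ^ m"] pos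
          by simp
        finally show "(\<rho> x / sqrt (real CARD('n))) ^ m
          \<le> (2 * \<rho> x / sqrt (real CARD('n))) ^ m * 2 ^ card (- I)" .
      qed
      finally have "\<epsilon> * r x ^ m \<le> \<epsilon> * A * ((2 * \<rho> x / sqrt (real CARD('n))) ^ m * 2 ^ card (- I))"
        using \<epsilon> by (simp add: mult.assoc)
      then have "\<mu> (cball x (r x)) \<le>
          ennreal (\<epsilon> * A * ((2 * \<rho> x / sqrt (real CARD('n))) ^ m * 2 ^ card (- I)))"
        using r(3)[OF xZ] by (meson ennreal_leI order_trans)
      also have "\<dots> = ennreal (\<epsilon> * A) * emeasure lborel (thick_box I (\<psi> x) (\<rho> x))"
        using pos \<epsilon> A by (subst emeasure_thick_box) (auto simp: m_def ennreal_mult)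
      finally show "\<mu> (cball x (r x)) \<le>
        emeasure (scale_measure (ennreal (\<epsilon> * A)) lborel) (thick_box I (\<psi> x) (\<rho> x))" by simp
    qed
    also have "\<dots> \<le> ennreal (\<epsilon> * A) * emeasure lborel D"
    proof -
      have "thick_box I (\<psi> x) (\<rho> x) \<subseteq> D" if "x \<in> J" for x
      proof -
        have xZ: "x \<in> Z" using that J(2) by auto
        have c: "\<bar>\<psi> x $ i\<bar> \<le> \<bar>K\<bar>" for i
          using K[of x] xZ component_le_norm_cart[of "\<psi> x" i] by (auto simp: Z_def)
        have "sqrt (real CARD('n)) \<ge> 1" by (simp add: Suc_leI)
        then have "\<rho> x \<le> sqrt (real CARD('n))"
          using \<rho>[OF xZ] by linarith
        then have le1: "\<rho> x / sqrt (real CARD('n)) \<le> 1"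
          by (simp add: field_simps)
        then show ?thesis
          unfolding thick_box_def D_def subset_iff mem_box_cart
        proof (intro allI impI)
          fix t i
          assume "\<forall>i. (\<chi> i. if i \<in> I then \<psi> x $ i - \<rho> x / sqrt (real CARD('n)) else - 1) $ i \<le> t $ i \<and>
            t $ i \<le> (\<chi> i. if i \<in> I then \<psi> x $ i + \<rho> x / sqrt (real CARD('n)) else 1) $ i"
          note ti = spec[OF this, of i]
          have "\<psi> x $ i - \<rho> x / sqrt (real CARD('n)) \<le> t $ i \<and>
            t $ i \<le> \<psi> x $ i + \<rho> x / sqrt (real CARD('n))" if "i \<in> I"
            using ti that by simp
          moreover have "- 1 \<le> t $ i \<and> t $ i \<le> 1" if "i \<notin> I"
            using ti that by simp
          ultimately have "- (\<bar>K\<bar> + 1) \<le> t $ i \<and> t $ i \<le> \<bar>K\<bar> + 1"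
            using c[of i] le1 by linarith
          then show "(\<chi> i. - (\<bar>K\<bar> + 1)) $ i \<le> t $ i \<and> t $ i \<le> (\<chi> i :: 'n. \<bar>K\<bar> + 1) $ i"
            by simp
        qed
      qed
      then have "(\<Union>x\<in>J. thick_box I (\<psi> x) (\<rho> x)) \<subseteq> D" by blast
      moreover have "D \<in> sets lborel" by (simp add: D_def)
      ultimately show ?thesis
        by (simp add: emeasure_mono mult_left_mono)
    qed
    also have "\<dots> = ennreal \<epsilon> * (ennreal A * emeasure lborel D)"
      using \<epsilon> A by (simp add: ennreal_mult mult.assoc)
    finally show ?thesis .
  qed
  have "emeasure lborel D < \<infinity>"
    unfolding D_def by (rule emeasure_lborel_cbox_finite)
  then have "ennreal A * emeasure lborel D < \<infinity>"
    by (simp add: ennreal_mult_less_top)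
  then obtain T where T: "T \<ge> 0" "ennreal A * emeasure lborel D = ennreal T"
    by (cases "ennreal A * emeasure lborel D" rule: ennreal_cases) auto
  have "\<mu> Z \<le> 0"
  proof (rule ennreal_le_epsilon)
    fix e :: real assume e: "0 < e"
    have "e / (T + 1) * T \<le> e" using e T(1) by (simp add: field_simps)
    then show "\<mu> Z \<le> 0 + ennreal e"
      using key[of "e / (T + 1)"] e T
      by (simp add: flip: ennreal_mult) (meson ennreal_leI order_trans)
  qed
  then show ?thesis by (simp add: Z_def m_def)
qed

section \<open>Bad cones\<close>

lemma infdist_orthogonal_sum:
  assumes "subspace V" "v \<in> V" "\<And>u. u \<in> V \<Longrightarrow> orthogonal w u"
  shows "infdist (v + w) V = norm w"
proof (rule antisym)
  show "infdist (v + w) V \<le> norm w"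
    using infdist_le[OF assms(2), of "v + w"] by (simp add: dist_norm)
  have "norm w \<le> dist (v + w) u" if "u \<in> V" for u
  proof -
    have "orthogonal (v - u) w"
      using assms(3)[of "v - u"] assms(1,2) that by (simp add: orthogonal_commute subspace_diff)
    then have "(norm ((v - u) + w))\<^sup>2 = (norm (v - u))\<^sup>2 + (norm w)\<^sup>2"
      by (rule norm_add_Pythagorean)
    then have "(norm w)\<^sup>2 \<le> (norm ((v - u) + w))\<^sup>2"
      using zero_le_power2[of "norm (v - u)"] by linarith
    then have "norm w \<le> norm ((v - u) + w)"
      by (rule power2_le_imp_le) (rule norm_ge_zero)
    moreover have "(v - u) + w = (v + w) - u" by simp
    ultimately show ?thesis by (simp only: dist_norm)
  qed
  moreover have "V \<noteq> {}" using assms(2) by auto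
  ultimately show "norm w \<le> infdist (v + w) V"
    by (auto simp: infdist_notempty intro!: cINF_greatest)
qed

text \<open>
  By Pythagoras the two distances in the definition of a bad cone are the norms of the
  orthogonal components.
\<close>

lemma bad_cone_orthogonal_sum:
  assumes "subspace V" "v \<in> V" "\<And>u. u \<in> V \<Longrightarrow> orthogonal w u"
  shows "v + w \<in> bad_cone V \<alpha> \<longleftrightarrow> norm w > \<alpha> * norm v"
proof -
  have "infdist (w + v) (V\<^sup>\<bottom>) = norm v"
  proof (rule infdist_orthogonal_sum)
    show "w \<in> V\<^sup>\<bottom>" using assms(3) by (auto simp: orthogonal_comp_def orthogonal_commute)
    show "orthogonal v u" if "u \<in> V\<^sup>\<bottom>" for u using that assms(2) by (auto simp: orthogonal_comp_def)
  qed (rule subspace_orthogonal_comp)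
  then show ?thesis
    using infdist_orthogonal_sum[OF assms] by (simp add: bad_cone_def add.commute)
qed

lemma bad_cone_scaleR:
  fixes V :: "'a::euclidean_space set"
  assumes "subspace V" "c > 0"
  shows "c *\<^sub>R z \<in> bad_cone V \<alpha> \<longleftrightarrow> z \<in> bad_cone V \<alpha>"
proof -
  obtain v w where vw: "v \<in> V" "\<And>u. u \<in> V \<Longrightarrow> orthogonal w u" "z = v + w"
    using orthogonal_subspace_decomp_exists[of V z] assms(1) by (metis span_eq_iff)
  have "c *\<^sub>R v \<in> V" "\<And>u. u \<in> V \<Longrightarrow> orthogonal (c *\<^sub>R w) u"
    using vw assms by (auto simp: subspace_scale orthogonal_def)
  from bad_cone_orthogonal_sum[OF assms(1) this, of \<alpha>]
  have "c *\<^sub>R z \<in> bad_cone V \<alpha> \<longleftrightarrow> norm (c *\<^sub>R w) > \<alpha> * norm (c *\<^sub>R v)"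
    using vw(3) by (simp add: scaleR_add_right)
  also have "\<dots> \<longleftrightarrow> c * norm w > c * (\<alpha> * norm v)"
    using assms(2) by (simp add: ac_simps)
  also have "\<dots> \<longleftrightarrow> norm w > \<alpha> * norm v"
    using assms(2) by simp
  also have "\<dots> \<longleftrightarrow> z \<in> bad_cone V \<alpha>"
    using bad_cone_orthogonal_sum[OF assms(1) vw(1,2)] vw(3) by simp
  finally show ?thesis .
qed

text \<open>
  Coordinates on \<open>V\<close> from an orthonormal basis indexed by \<open>I\<close>. Outside the bad cone the part
  of \<open>x - y\<close> orthogonal to \<open>V\<close> is controlled by the part in \<open>V\<close>, so these coordinates
  determine the point with a Lipschitz bound.
\<close>

lemma outside_bad_cone_coordinates:
  fixes V :: "(real ^ 'n::finite) set"
  assumes V: "subspace V" and "\<alpha> > 0"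
  obtains I :: "'n set" and \<psi> :: "real ^ 'n \<Rightarrow> real ^ 'n" and C :: real
  where "card I = dim V" "linear \<psi>" "\<And>x i. i \<notin> I \<Longrightarrow> \<psi> x $ i = 0"
    "\<And>x y. x - y \<notin> bad_cone V \<alpha> \<Longrightarrow> dist x y \<le> C * dist (\<psi> x) (\<psi> y)"
proof -
  obtain B where B: "B \<subseteq> V" "pairwise orthogonal B" "\<And>b. b \<in> B \<Longrightarrow> norm b = 1"
    "independent B" "card B = dim V" "span B = V"
    using orthonormal_basis_subspace[OF V] by metis
  have fin: "finite B" using B(4) by (rule independent_imp_finite)
  have "card B \<le> CARD('n)"
    using dim_subset_UNIV_cart[of V] B(5) by simp
  then obtain I :: "'n set" where I: "card I = card B"
    using obtain_subset_with_card_n by blast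
  then obtain e where e: "bij_betw e I B"
    using fin bij_betw_iff_card[of I B] by auto
  define \<psi> where "\<psi> x = (\<chi> i. if i \<in> I then e i \<bullet> x else 0)" for x :: "real ^ 'n"
  have lin: "linear \<psi>"
    by (rule linearI) (auto simp: \<psi>_def vec_eq_iff inner_add_right)
  have diff: "\<psi> x - \<psi> y = \<psi> (x - y)" for x y
    using lin by (simp add: linear_diff)
  have bound: "norm z \<le> (1 + \<alpha>) * real (card I) * norm (\<psi> z)" if z: "z \<notin> bad_cone V \<alpha>" for z
  proof -
    obtain v w where vw: "v \<in> V" "\<And>u. u \<in> V \<Longrightarrow> orthogonal w u" "z = v + w"
      using orthogonal_subspace_decomp_exists[of V z] V by (metis span_eq_iff)
    have "norm w \<le> \<alpha> * norm v"
      using z bad_cone_orthogonal_sum[OF V vw(1,2), of \<alpha>] vw(3) by (simp add: not_less)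
    then have "norm z \<le> (1 + \<alpha>) * norm v"
      using norm_triangle_ineq[of v w] vw(3) by (simp add: algebra_simps)
    moreover have "norm v \<le> real (card I) * norm (\<psi> z)"
    proof -
      have "v \<in> span B" using vw(1) B(6) by simp
      with B(2,3) have "(\<Sum>b\<in>B. (v \<bullet> b) *\<^sub>R b) = v"
        using fin by (rule orthonormal_basis_expand)
      then have "norm v = norm (\<Sum>b\<in>B. (v \<bullet> b) *\<^sub>R b)" by (rule arg_cong[OF sym])
      also have "\<dots> \<le> (\<Sum>b\<in>B. norm ((v \<bullet> b) *\<^sub>R b))"
        by (rule norm_sum)
      also have "\<dots> = (\<Sum>b\<in>B. \<bar>v \<bullet> b\<bar>)" using B(3) by simp
      also have "\<dots> = (\<Sum>i\<in>I. \<bar>v \<bullet> e i\<bar>)"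
        using sum.reindex_bij_betw[OF e, of "\<lambda>b. \<bar>v \<bullet> b\<bar>"] by simp
      also have "\<dots> \<le> (\<Sum>i\<in>I. norm (\<psi> z))"
      proof (rule sum_mono)
        fix i assume i: "i \<in> I"
        then have "e i \<in> V" using e B(1) by (auto simp: bij_betw_def)
        then have "e i \<bullet> w = 0" using vw(2)[of "e i"] by (simp add: orthogonal_def inner_commute)
        then have "v \<bullet> e i = \<psi> z $ i"
          using vw(3) i by (simp add: \<psi>_def inner_add_right inner_commute)
        then show "\<bar>v \<bullet> e i\<bar> \<le> norm (\<psi> z)"
          using component_le_norm_cart[of "\<psi> z" i] by simp
      qed
      finally show ?thesis by simp
    qed
    ultimately have "norm z \<le> (1 + \<alpha>) * (real (card I) * norm (\<psi> z))"
      using \<open>\<alpha> > 0\<close> by (meson add_pos_pos less_imp_le mult_left_mono order_trans zero_less_one)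
    then show ?thesis by (simp only: mult.assoc)
  qed
  show ?thesis
  proof
    show "card I = dim V" using I B(5) by simp
    show "linear \<psi>" by (rule lin)
    show "\<psi> x $ i = 0" if "i \<notin> I" for x i using that by (simp add: \<psi>_def)
    show "dist x y \<le> (1 + \<alpha>) * real (card I) * dist (\<psi> x) (\<psi> y)"
      if "x - y \<notin> bad_cone V \<alpha>" for x y
      using bound[OF that] by (simp add: dist_norm diff)
  qed
qed

section \<open>Dyadic cubes\<close>

lemma dyadic_cube_iff_floor:
  "x \<in> dyadic_cube k j \<longleftrightarrow> (\<forall>i. \<lfloor>2 powi k * x $ i\<rfloor> = j i)"
proof -
  have "of_int (j i) * 2 powi (- k) \<le> x $ i \<and> x $ i < (of_int (j i) + 1) * 2 powi (- k)
    \<longleftrightarrow> \<lfloor>2 powi k * x $ i\<rfloor> = j i" for i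
    by (simp add: floor_eq_iff power_int_minus field_simps)
  then show ?thesis by (simp add: dyadic_cube_def)
qed

text \<open>The rounded coordinates are the index of the one cube of generation \<open>k\<close> containing \<open>x\<close>.\<close>

definition cube_at :: "nat \<Rightarrow> real ^ 'n::finite \<Rightarrow> (real ^ 'n) set" where
  "cube_at k x = dyadic_cube (int k) (\<lambda>i. \<lfloor>2 ^ k * x $ i\<rfloor>)"

lemma mem_cube_at_iff: "y \<in> cube_at k x \<longleftrightarrow> (\<forall>i. \<lfloor>2 ^ k * y $ i\<rfloor> = \<lfloor>2 ^ k * x $ i\<rfloor>)"
  by (simp add: cube_at_def dyadic_cube_iff_floor)

lemma cube_at_self [simp]: "x \<in> cube_at k x"
  by (simp add: mem_cube_at_iff)

lemma cube_at_eq: "y \<in> cube_at k x \<Longrightarrow> cube_at k y = cube_at k x"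
  by (auto simp: mem_cube_at_iff)

lemma cube_at_antimono:
  assumes "j \<le> k"
  shows "cube_at k x \<subseteq> cube_at j x"
proof
  fix y assume y: "y \<in> cube_at k x"
  have *: "\<lfloor>2 ^ j * z\<rfloor> = \<lfloor>2 ^ k * z\<rfloor> div 2 ^ (k - j)" for z :: real
  proof -
    have "2 ^ k = (2 ^ j * 2 ^ (k - j) :: real)"
      using assms by (simp flip: power_add)
    then have "2 ^ j * z = (2 ^ k * z) / of_int (2 ^ (k - j))"
      by simp
    then show ?thesis
      using floor_divide_real_eq_div[of "2 ^ (k - j)" "2 ^ k * z"] by simp
  qed
  show "y \<in> cube_at j x" using y by (simp add: mem_cube_at_iff *)
qed

lemma cube_at_eq_coarser: "y \<in> cube_at k x \<Longrightarrow> j \<le> k \<Longrightarrow> cube_at j y = cube_at j x"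
  using cube_at_antimono cube_at_eq by blast

lemma cube_at_in_dyadic_cubes: "cube_at k x \<in> dyadic_cubes"
  by (auto simp: cube_at_def dyadic_cubes_def)

lemma side_cube_at: "side (cube_at k x) = 1 / 2 ^ k"
  by (simp add: cube_at_def side_dyadic_cube power_int_minus field_simps)

lemma countable_dyadic_cubes: "countable (dyadic_cubes :: (real ^ 'n::finite) set set)"
proof -
  have "dyadic_cubes = (\<lambda>(k, j). dyadic_cube k j :: (real ^ 'n) set) ` UNIV"
    by (auto simp: dyadic_cubes_def)
  then show ?thesis by (metis countable_image countableI_type)
qed

lemma dyadic_cube_borel: "dyadic_cube k j \<in> sets borel"
proof -
  have "dyadic_cube k j = (\<Inter>i. {x. of_int (j i) * 2 powi (- k) \<le> x $ i} \<inter>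
      {x. x $ i < (of_int (j i) + 1) * 2 powi (- k)})"
    by (auto simp: dyadic_cube_def)
  also have "\<dots> \<in> sets borel"
    by (intro sets.countable_INT'' sets.Int borel_closed borel_open
        closed_Collect_le open_Collect_less continuous_intros) auto
  finally show ?thesis .
qed

lemma cube_at_borel: "cube_at k x \<in> sets borel"
  by (simp add: cube_at_def dyadic_cube_borel)

lemma dyadic_cubes_borel: "R \<in> dyadic_cubes \<Longrightarrow> R \<in> sets borel"
  by (auto simp: dyadic_cubes_def dyadic_cube_borel)

text \<open>
  Measurability without measurable functions: a set decided by the cube of one generation is a
  countable union of cubes.
\<close>

lemma cube_at_closed_imp_borel:
  fixes S :: "(real ^ 'n::finite) set"
  assumes "\<And>x y. x \<in> S \<Longrightarrow> y \<in> cube_at k x \<Longrightarrow> y \<in> S"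
  shows "S \<in> sets borel"
proof -
  have "S = \<Union> (cube_at k ` S)" using assms by auto
  moreover have "countable (cube_at k ` S)"
    using countable_dyadic_cubes by (rule countable_subset[rotated]) (auto simp: cube_at_in_dyadic_cubes)
  ultimately show ?thesis
    using cube_at_borel by (metis (no_types, lifting) imageE sets.countable_Union subsetI)
qed

lemma dist_cube_at:
  fixes x y :: "real ^ 'n::finite"
  assumes "y \<in> cube_at k x"
  shows "dist x y \<le> sqrt (real CARD('n)) / 2 ^ k"
proof -
  have "\<bar>(x - y) $ i\<bar> \<le> 1 / 2 ^ k" for i
  proof -
    have "\<lfloor>2 ^ k * y $ i\<rfloor> = \<lfloor>2 ^ k * x $ i\<rfloor>" using assms by (simp add: mem_cube_at_iff)
    then have "\<bar>2 ^ k * x $ i - 2 ^ k * y $ i\<bar> < 1" by linarith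
    then have "2 ^ k * \<bar>x $ i - y $ i\<bar> < 1"
      by (simp add: abs_mult flip: right_diff_distrib)
    then show ?thesis by (simp add: field_simps)
  qed
  from norm_vec_le_sqrt_CARD[OF this] show ?thesis by (simp add: dist_norm)
qed

lemma dist_center_cube_at:
  fixes x :: "real ^ 'n::finite"
  shows "dist (center (cube_at k x)) x \<le> sqrt (real CARD('n)) / 2 ^ k"
proof -
  have "center (cube_at k x) \<in> cube_at k x"
    by (auto simp: cube_at_def center_dyadic_cube dyadic_cube_iff_floor floor_eq_iff
        power_int_minus field_simps)
  then show ?thesis using dist_cube_at by (metis dist_commute)
qed

lemma bounded_cube_at: "bounded (cube_at k x)"
  using dist_cube_at unfolding bounded_def by blast

lemma finite_dyadic_indices_meeting_bounded:
  fixes S :: "(real ^ 'n::finite) set"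
  assumes "bounded S"
  shows "finite {j. dyadic_cube k j \<inter> S \<noteq> {}}"
proof -
  obtain K where K: "\<And>y. y \<in> S \<Longrightarrow> norm y \<le> K"
    using assms by (auto simp: bounded_iff)
  let ?J = "{- \<lceil>2 powi k * K\<rceil> - 1 .. \<lceil>2 powi k * K\<rceil> + 1}"
  have "j i \<in> ?J" if y: "y \<in> dyadic_cube k j" "y \<in> S" for y j i
  proof -
    have "\<bar>y $ i\<bar> \<le> K" using K[OF y(2)] component_le_norm_cart[of y i] by linarith
    then have "\<bar>2 powi k * y $ i\<bar> \<le> 2 powi k * K" by (simp add: abs_mult)
    moreover have "j i = \<lfloor>2 powi k * y $ i\<rfloor>" using y(1) by (simp add: dyadic_cube_iff_floor)
    ultimately show ?thesis unfolding atLeastAtMost_iff by linarith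
  qed
  then have "{j. dyadic_cube k j \<inter> S \<noteq> {}} \<subseteq> {j. \<forall>i. j i \<in> ?J}" by blast
  moreover have "finite {f :: 'n \<Rightarrow> int. \<forall>i. f i \<in> ?J}"
    using finite_PiE[of "UNIV :: 'n set" "\<lambda>_. ?J"] by (simp add: PiE_UNIV_domain Pi_def)
  ultimately show ?thesis by (rule finite_subset)
qed

lemma finite_cubes_in_cube_at: "finite (cube_at k ` cube_at j x)"
proof -
  have "cube_at k ` cube_at j x \<subseteq> dyadic_cube (int k) ` {l. dyadic_cube (int k) l \<inter> cube_at j x \<noteq> {}}"
  proof
    fix Q assume "Q \<in> cube_at k ` cube_at j x"
    then obtain y where y: "y \<in> cube_at j x" "Q = cube_at k y" by auto
    then have "y \<in> dyadic_cube (int k) (\<lambda>i. \<lfloor>2 ^ k * y $ i\<rfloor>) \<inter> cube_at j x"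
      using cube_at_self[of y k] by (simp only: cube_at_def Int_iff)
    then show "Q \<in> dyadic_cube (int k) ` {l. dyadic_cube (int k) l \<inter> cube_at j x \<noteq> {}}"
      unfolding y(2) cube_at_def[of k y] by blast
  qed
  then show ?thesis
    by (rule finite_subset) (intro finite_imageI finite_dyadic_indices_meeting_bounded bounded_cube_at)
qed

section \<open>The annulus cubes up to translation and scaling\<close>

text \<open>
  Since a bad cone is invariant under dilation, the annulus cubes of every dyadic cube are its
  translates by these grid vectors, scaled by its side.
\<close>

definition annulus_indices :: "(real ^ 'n::finite) set \<Rightarrow> real \<Rightarrow> ('n \<Rightarrow> int) set" where
  "annulus_indices V \<alpha> = {l. dyadic_cube 0 l \<inter> cone_annulus V \<alpha> (dyadic_cube 0 (\<lambda>_. 0)) \<noteq> {}}"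

lemma mem_cone_at_iff: "x \<in> cone_at X Q \<longleftrightarrow> (\<exists>q\<in>Q. x - q \<in> X)"
proof -
  have "x \<in> (+) q ` X \<longleftrightarrow> x - q \<in> X" for q
    by (auto intro: image_eqI[of _ _ "x - q"])
  then show ?thesis by (simp add: cone_at_def)
qed

lemma finite_annulus_indices: "finite (annulus_indices V \<alpha>)"
  unfolding annulus_indices_def
  by (rule finite_dyadic_indices_meeting_bounded, rule bounded_subset[OF bounded_cball])
     (auto simp: cone_annulus_def)

lemma annulus_cubes_dyadic_cube:
  fixes V :: "(real ^ 'n::finite) set"
  assumes V: "subspace V"
  shows "annulus_cubes V \<alpha> (dyadic_cube k j) =
    (\<lambda>l. dyadic_cube k (\<lambda>i. j i + l i)) ` annulus_indices V \<alpha>"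
proof -
  \<comment> \<open>the similarity \<open>T\<close> carries the unit cube at the origin to the given cube, and all data with it\<close>
  let ?s = "2 powi (- k) :: real"
  let ?Q = "dyadic_cube k j" and ?U = "dyadic_cube 0 (\<lambda>_. 0) :: (real ^ 'n) set"
  define T where "T y = (\<chi> i. ?s * (y $ i + of_int (j i)))" for y :: "real ^ 'n"
  have T_surj: "\<exists>y. x = T y" for x
    by (rule exI[of _ "\<chi> i. 2 powi k * x $ i - of_int (j i)"])
       (simp add: T_def vec_eq_iff power_int_minus)
  have T_diff: "T y - T z = ?s *\<^sub>R (y - z)" for y z
    by (simp add: T_def vec_eq_iff algebra_simps)
  then have T_dist: "dist (T y) (T z) = ?s * dist y z" for y z
    by (simp add: dist_norm)
  have T_cube: "T y \<in> dyadic_cube k (\<lambda>i. j i + l i) \<longleftrightarrow> y \<in> dyadic_cube 0 l" for y l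
  proof -
    have "2 powi k * T y $ i = y $ i + of_int (j i)" for i
      by (simp add: T_def power_int_minus)
    then show ?thesis by (simp add: dyadic_cube_iff_floor)
  qed
  have T_Q: "T y \<in> ?Q \<longleftrightarrow> y \<in> ?U" for y
    using T_cube[of y "\<lambda>_. 0"] by simp
  have T_center: "center ?Q = T (center ?U)"
    by (simp add: center_dyadic_cube T_def vec_eq_iff algebra_simps)
  have T_radius: "cone_radius \<alpha> ?Q = ?s * cone_radius \<alpha> ?U"
    by (simp add: cone_radius_def side_dyadic_cube)
  have "T y \<in> cone_at (bad_cone V \<alpha>) ?Q \<longleftrightarrow> y \<in> cone_at (bad_cone V \<alpha>) ?U" for y
  proof -
    have "(\<exists>q\<in>?Q. T y - q \<in> bad_cone V \<alpha>) \<longleftrightarrow> (\<exists>p\<in>?U. T y - T p \<in> bad_cone V \<alpha>)"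
      by (metis T_surj T_Q)
    then show ?thesis
      by (simp add: mem_cone_at_iff T_diff bad_cone_scaleR[OF V])
  qed
  then have T_annulus: "T y \<in> cone_annulus V \<alpha> ?Q \<longleftrightarrow> y \<in> cone_annulus V \<alpha> ?U" for y
    by (simp add: cone_annulus_def T_center T_radius T_dist mult_le_cancel_left_pos
        mult_less_cancel_left_pos flip: times_divide_eq_right)
  have index: "dyadic_cube k (\<lambda>i. j i + l i) \<inter> cone_annulus V \<alpha> ?Q \<noteq> {} \<longleftrightarrow> l \<in> annulus_indices V \<alpha>" for l
    unfolding annulus_indices_def using T_surj T_cube T_annulus by (auto simp: set_eq_iff) metis+
  show ?thesis
  proof (intro equalityI subsetI)
    fix R assume "R \<in> annulus_cubes V \<alpha> ?Q"
    then obtain k' j' where R: "R = dyadic_cube k' j'" "side R = side ?Q" "R \<inter> cone_annulus V \<alpha> ?Q \<noteq> {}"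
      by (auto simp: annulus_cubes_def dyadic_cubes_def)
    have "k' = k"
      using R(2) power_int_strict_increasing[of "- k'" "- k" "2 :: real"]
        power_int_strict_increasing[of "- k" "- k'" "2 :: real"]
      by (cases k k' rule: linorder_cases) (auto simp: R(1) side_dyadic_cube)
    then have R': "R = dyadic_cube k (\<lambda>i. j i + (j' i - j i))" using R(1) by simp
    then have "(\<lambda>i. j' i - j i) \<in> annulus_indices V \<alpha>"
      using R(3) index[of "\<lambda>i. j' i - j i"] by simp
    with R' show "R \<in> (\<lambda>l. dyadic_cube k (\<lambda>i. j i + l i)) ` annulus_indices V \<alpha>"
      by (rule image_eqI)
  next
    fix R assume "R \<in> (\<lambda>l. dyadic_cube k (\<lambda>i. j i + l i)) ` annulus_indices V \<alpha>"
    then show "R \<in> annulus_cubes V \<alpha> ?Q"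
      using index by (auto simp: annulus_cubes_def dyadic_cubes_def side_dyadic_cube)
  qed
qed

lemma finite_annulus_cubes:
  assumes "subspace V" "Q \<in> dyadic_cubes"
  shows "finite (annulus_cubes V \<alpha> Q)"
  using assms by (auto simp: dyadic_cubes_def annulus_cubes_dyadic_cube finite_annulus_indices)

text \<open>
  The Dini function depends on the cone only through a finite set of grid indices. There are
  countably many such sets, which tames the uncountable family of bad cones.
\<close>

lemma conical_dini_cong:
  assumes "subspace V" "subspace V'" "annulus_indices V \<alpha> = annulus_indices V' \<alpha>'"
  shows "conical_dini \<mu> V \<alpha> = conical_dini \<mu> V' \<alpha>'"
proof -
  have "annulus_cubes V \<alpha> Q = annulus_cubes V' \<alpha>' Q" if "Q \<in> dyadic_cubes" for Q
    using that assms by (auto simp: dyadic_cubes_def annulus_cubes_dyadic_cube)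
  then have "defect \<mu> Q V \<alpha> = defect \<mu> Q V' \<alpha>'" if "Q \<in> dyadic_cubes" for Q
    using that by (simp add: defect_def)
  then show ?thesis
    unfolding conical_dini_def by (intro ext infsum_cong) auto
qed

text \<open>The cubes containing \<open>x\<close> of generations below \<open>K\<close> are distinct terms of the Dini series.\<close>

lemma sum_defect_le_conical_dini:
  "(\<Sum>k<K. defect \<mu> (cube_at k x) V \<alpha>) \<le> conical_dini \<mu> V \<alpha> x"
proof -
  have inj: "inj_on (\<lambda>k. cube_at k x) {..<K}"
  proof (rule inj_onI)
    fix k l assume "cube_at k x = cube_at l x"
    then have "side (cube_at k x) = side (cube_at l x)" by simp
    then show "k = l" by (simp add: side_cube_at)
  qed
  let ?f = "\<lambda>Q. defect \<mu> Q V \<alpha> * indicator Q x"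
  have "(\<Sum>k<K. defect \<mu> (cube_at k x) V \<alpha>) = (\<Sum>k<K. ?f (cube_at k x))" by simp
  also have "\<dots> = sum ?f ((\<lambda>k. cube_at k x) ` {..<K})"
    by (simp only: sum.reindex[OF inj] comp_def)
  also have "\<dots> = infsum ?f ((\<lambda>k. cube_at k x) ` {..<K})" by simp
  also have "\<dots> \<le> infsum ?f {Q \<in> dyadic_cubes. side Q \<le> 1}"
    by (rule infsum_mono_neutral)
       (auto intro: nonneg_summable_on_complete simp: cube_at_in_dyadic_cubes side_cube_at)
  finally show ?thesis by (simp add: conical_dini_def)
qed

lemma defect_times_measure:
  assumes "radon_measure \<mu>" "subspace V" "\<mu> (cube_at k x) > 0"
  shows "defect \<mu> (cube_at k x) V \<alpha> * \<mu> (cube_at k x) = (\<Sum>R\<in>annulus_cubes V \<alpha> (cube_at k x). \<mu> R)"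
proof -
  have "\<mu> (cube_at k x) < \<infinity>"
    using radon_measure_bounded_finite[OF assms(1) bounded_cube_at] .
  then have "r / \<mu> (cube_at k x) * \<mu> (cube_at k x) = r" for r
    using assms(3) by (simp add: ennreal_divide_times ennreal_divide_self mult_divide_eq_ennreal)
  then show ?thesis
    using assms finite_annulus_cubes[OF assms(2) cube_at_in_dyadic_cubes]
    by (simp add: defect_def sum_distrib_right)
qed

text \<open>
  Consecutive annuli overlap: the ratio of their radii is 3 while scales are dyadic, and the
  factor 81 makes the side of the cube negligible against both. Hence every point of the cone at
  \<open>y\<close> close to \<open>y\<close> is caught by the annulus of some small cube containing \<open>y\<close>.
\<close>

lemma cone_point_in_some_annulus:
  fixes x y :: "real ^ 'n::finite"
  assumes V: "subspace V" and \<alpha>: "\<alpha> > 0" and cone: "x - y \<in> bad_cone V \<alpha>"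
    and close: "dist x y \<le> sqrt (real CARD('n)) / 2 ^ k0"
  shows "\<exists>k\<ge>k0. cube_at k x \<in> annulus_cubes V \<alpha> (cube_at k y)"
proof -
  define q where "q = sqrt (real CARD('n))"
  define b where "b = 81 * q * max \<alpha> (1 / \<alpha>)"
  have q: "q \<ge> 1" by (simp add: q_def Suc_leI)
  have "\<alpha> \<ge> 1 \<or> 1 / \<alpha> \<ge> 1" using \<alpha> by (simp add: field_simps) linarith
  then have "max \<alpha> (1 / \<alpha>) \<ge> 1" by (simp add: le_max_iff_disj)
  then have b: "81 * q \<le> b" using q mult_left_mono[of 1 "max \<alpha> (1 / \<alpha>)" "81 * q"] by (simp add: b_def)
  define d where "d = dist x y"
  have "x \<noteq> y"
  proof
    assume "x = y"
    then have "0 \<in> bad_cone V \<alpha>" using cone by simp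
    then show False
      using bad_cone_orthogonal_sum[OF V subspace_0[OF V], of 0 \<alpha>] by (simp add: orthogonal_def)
  qed
  then have d: "d > 0" by (simp add: d_def)
  \<comment> \<open>the first generation whose annulus has middle radius below \<open>d\<close>\<close>
  define k where "k = (LEAST k. 2 * b < 5 * d * 2 ^ k)"
  obtain k1 :: nat where "2 * b / (5 * d) < 2 ^ k1"
    using real_arch_pow[of 2 "2 * b / (5 * d)"] by auto
  then have "2 * b < 5 * d * 2 ^ k1" using d by (simp add: field_simps)
  then have k: "2 * b < 5 * d * 2 ^ k" unfolding k_def by (rule LeastI)
  have before: "5 * d * 2 ^ l \<le> 2 * b" if "l < k" for l
    using not_less_Least[OF that[unfolded k_def]] by simp
  have "d * 2 ^ k0 \<le> q" using close by (simp add: d_def q_def field_simps)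
  have "k0 < k"
  proof (rule ccontr)
    assume "\<not> k0 < k"
    then have "d * 2 ^ k \<le> d * 2 ^ k0" using d by (intro mult_left_mono power_increasing) auto
    then show False using k b q \<open>d * 2 ^ k0 \<le> q\<close> by linarith
  qed
  have "5 * d * 2 ^ k \<le> 4 * b"
    using before[of "k - 1"] \<open>k0 < k\<close> by (cases k) auto
  define c where "c = center (cube_at k y)"
  have "dist c x \<le> d + q / 2 ^ k" "d \<le> dist c x + q / 2 ^ k"
    using dist_center_cube_at[of k y] dist_triangle[of c x y] dist_triangle[of x y c]
    unfolding c_def d_def q_def by (simp_all add: dist_commute)
  then have "dist c x * 2 ^ k \<le> d * 2 ^ k + q" "d * 2 ^ k \<le> dist c x * 2 ^ k + q"
    by (simp_all add: field_simps)
  then have "dist c x * 2 ^ k \<le> b" "b \<le> 3 * (dist c x * 2 ^ k)"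
    using k \<open>5 * d * 2 ^ k \<le> 4 * b\<close> b by linarith+
  then have "dist c x \<le> b / 2 ^ k" "b / 2 ^ k / 3 \<le> dist c x"
    by (simp_all add: field_simps)
  moreover have "cone_radius \<alpha> (cube_at k y) = b / 2 ^ k"
    by (simp add: cone_radius_def side_cube_at b_def q_def)
  moreover have "x \<in> cone_at (bad_cone V \<alpha>) (cube_at k y)"
    using cone cube_at_self by (auto simp: mem_cone_at_iff)
  ultimately have "x \<in> cone_annulus V \<alpha> (cube_at k y)"
    by (simp add: cone_annulus_def c_def not_less)
  then have "cube_at k x \<inter> cone_annulus V \<alpha> (cube_at k y) \<noteq> {}"
    using cube_at_self[of x k] by blast
  then have "cube_at k x \<in> annulus_cubes V \<alpha> (cube_at k y)"
    by (simp add: annulus_cubes_def cube_at_in_dyadic_cubes side_cube_at)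
  then show ?thesis using \<open>k0 < k\<close> by (meson less_imp_le)
qed

section \<open>Stopping time and Borel-Cantelli\<close>

text \<open>
  Points around which \<open>F\<close> fills more than the fraction \<open>1 / c\<close> of each dyadic cube. The strict
  inequality excludes null cubes, whose defect is 0 by convention and carries no information.
\<close>

definition visible_points ::
    "((real ^ 'n::finite) set \<Rightarrow> ennreal) \<Rightarrow> (real ^ 'n) set \<Rightarrow> real \<Rightarrow> (real ^ 'n) set" where
  "visible_points \<mu> F c = {x \<in> F. \<forall>k. \<mu> (cube_at k x) < ennreal c * \<mu> (F \<inter> cube_at k x)}"

text \<open>
  The invisible points are covered by the maximal cubes in which \<open>F\<close> has small proportion. These
  are disjoint, so \<open>F\<close> meets their union in a small set.
\<close>

lemma measure_invisible_points:
  fixes x0 :: "real ^ 'n::finite"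
  assumes rad: "radon_measure \<mu>" and F: "F \<subseteq> cube_at 0 x0" and c: "c > 0"
  shows "\<mu> (F - visible_points \<mu> F c) \<le> ennreal (1 / c) * \<mu> (cube_at 0 x0)"
proof -
  have om: "outer_measure_space UNIV \<mu>" using rad by (simp add: radon_measure_def)
  define bad where "bad k x \<longleftrightarrow> ennreal c * \<mu> (F \<inter> cube_at k x) \<le> \<mu> (cube_at k x)" for k x
  \<comment> \<open>minimal generation for a point is maximality for its cube\<close>
  define first where "first k x \<longleftrightarrow> bad k x \<and> (\<forall>j<k. \<not> bad j x)" for k x
  define \<Q> where "\<Q> = {cube_at k x | k x. x \<in> F \<and> first k x}"
  define N where "N = scale_measure (ennreal (1 / c)) (borel_restriction \<mu>)"
  have \<Q>: "countable \<Q>"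
    by (rule countable_subset[OF _ countable_dyadic_cubes]) (auto simp: \<Q>_def cube_at_in_dyadic_cubes)
  have borel: "Q \<in> sets borel" if "Q \<in> \<Q>" for Q
    using that cube_at_borel by (auto simp: \<Q>_def)
  have "F - visible_points \<mu> F c \<subseteq> (\<Union>Q\<in>\<Q>. F \<inter> Q)"
  proof
    fix x assume x: "x \<in> F - visible_points \<mu> F c"
    then obtain k where "bad k x" by (auto simp: visible_points_def bad_def not_less)
    then have "first (LEAST k. bad k x) x"
      using not_less_Least by (auto simp: first_def intro: LeastI)
    then have "cube_at (LEAST k. bad k x) x \<in> \<Q>" using x unfolding \<Q>_def by blast
    then show "x \<in> (\<Union>Q\<in>\<Q>. F \<inter> Q)" using x cube_at_self by blast
  qed
  then have "\<mu> (F - visible_points \<mu> F c) \<le> \<mu> (\<Union>Q\<in>\<Q>. F \<inter> Q)"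
    by (rule outer_measure_mono[OF om])
  also have "\<dots> \<le> emeasure N (\<Union>Q\<in>\<Q>. Q)"
  proof (rule outer_measure_UN_le_emeasure_UN[OF om \<Q>])
    show "disjoint_family_on (\<lambda>Q. Q) \<Q>"
      unfolding disjoint_family_on_def
    proof (intro ballI impI)
      fix Q R assume QR: "Q \<in> \<Q>" "R \<in> \<Q>" "Q \<noteq> R"
      then obtain k x l y where Q: "Q = cube_at k x" "first k x" and R: "R = cube_at l y" "first l y"
        by (auto simp: \<Q>_def)
      show "Q \<inter> R = {}"
      proof (rule ccontr)
        assume "Q \<inter> R \<noteq> {}"
        then obtain z where z: "z \<in> cube_at k x" "z \<in> cube_at l y" using Q R by auto
        have "bad j z \<longleftrightarrow> bad j x" if "j \<le> k" for j
          using cube_at_eq_coarser[OF z(1) that] by (simp add: bad_def)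
        then have "first k z" using Q(2) by (simp add: first_def)
        have "bad j z \<longleftrightarrow> bad j y" if "j \<le> l" for j
          using cube_at_eq_coarser[OF z(2) that] by (simp add: bad_def)
        then have "first l z" using R(2) by (simp add: first_def)
        with \<open>first k z\<close> have "k = l"
          unfolding first_def by (metis linorder_neqE_nat)
        then show False using QR(3) Q(1) R(1) cube_at_eq[OF z(1)] cube_at_eq[OF z(2)] by simp
      qed
    qed
    show "Q \<in> sets N" if "Q \<in> \<Q>" for Q using borel[OF that] by (simp add: N_def)
    fix Q assume Q: "Q \<in> \<Q>"
    then have "ennreal c * \<mu> (F \<inter> Q) \<le> \<mu> Q" by (auto simp: \<Q>_def first_def bad_def)
    then have "ennreal (1 / c) * (ennreal c * \<mu> (F \<inter> Q)) \<le> ennreal (1 / c) * \<mu> Q"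
      by (rule mult_left_mono) simp
    moreover have "ennreal (1 / c) * (ennreal c * \<mu> (F \<inter> Q)) = \<mu> (F \<inter> Q)"
      using c by (simp flip: mult.assoc ennreal_mult)
    ultimately show "\<mu> (F \<inter> Q) \<le> emeasure N Q"
      using emeasure_borel_restriction[OF rad borel[OF Q]] by (simp add: N_def)
  qed
  also have "\<dots> \<le> emeasure N (cube_at 0 x0)"
  proof (rule emeasure_mono)
    show "(\<Union>Q\<in>\<Q>. Q) \<subseteq> cube_at 0 x0"
    proof
      fix z assume "z \<in> (\<Union>Q\<in>\<Q>. Q)"
      then obtain k x where x: "x \<in> F" "z \<in> cube_at k x" unfolding \<Q>_def by blast
      then have "z \<in> cube_at 0 x" using cube_at_antimono[of 0 k x] by auto
      also have "\<dots> = cube_at 0 x0" using x(1) F by (intro cube_at_eq) auto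
      finally show "z \<in> cube_at 0 x0" .
    qed
    show "cube_at 0 x0 \<in> sets N" by (simp add: N_def cube_at_borel)
  qed
  also have "\<dots> = ennreal (1 / c) * \<mu> (cube_at 0 x0)"
    using emeasure_borel_restriction[OF rad cube_at_borel] by (simp add: N_def)
  finally show ?thesis .
qed

text \<open>
  Bounding the partial sums over the generations, in place of the Dini function itself, exhibits
  a countable intersection of sets that are decided by the cube of one generation.
\<close>

definition dini_bounded ::
    "((real ^ 'n::finite) set \<Rightarrow> ennreal) \<Rightarrow> (real ^ 'n) set \<Rightarrow> real \<Rightarrow> nat \<Rightarrow> real ^ 'n \<Rightarrow> (real ^ 'n) set" where
  "dini_bounded \<mu> V \<alpha> N x0 =
     {x \<in> cube_at 0 x0. \<forall>K. (\<Sum>k<K. defect \<mu> (cube_at k x) V \<alpha>) \<le> of_nat N}"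

lemma dini_bounded_borel: "dini_bounded \<mu> V \<alpha> N x0 \<in> sets borel"
proof -
  have "{x \<in> cube_at 0 x0. (\<Sum>k<K. defect \<mu> (cube_at k x) V \<alpha>) \<le> of_nat N} \<in> sets borel" for K
  proof (rule cube_at_closed_imp_borel)
    fix x y
    assume x: "x \<in> {x \<in> cube_at 0 x0. (\<Sum>k<K. defect \<mu> (cube_at k x) V \<alpha>) \<le> of_nat N}"
      and y: "y \<in> cube_at K x"
    have "cube_at k y = cube_at k x" if "k \<le> K" for k
      using cube_at_eq_coarser[OF y that] .
    moreover from this[of 0] have "y \<in> cube_at 0 x0"
      using x cube_at_eq[of x 0 x0] cube_at_self[of y 0] by auto
    ultimately show "y \<in> {x \<in> cube_at 0 x0. (\<Sum>k<K. defect \<mu> (cube_at k x) V \<alpha>) \<le> of_nat N}"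
      using x by simp
  qed
  moreover have "dini_bounded \<mu> V \<alpha> N x0 =
      (\<Inter>K. {x \<in> cube_at 0 x0. (\<Sum>k<K. defect \<mu> (cube_at k x) V \<alpha>) \<le> of_nat N})"
    by (auto simp: dini_bounded_def)
  ultimately show ?thesis by auto
qed

definition annulus_trace ::
    "(real ^ 'n::finite) set \<Rightarrow> real \<Rightarrow> (real ^ 'n) set \<Rightarrow> nat \<Rightarrow> (real ^ 'n) set" where
  "annulus_trace V \<alpha> S k = (\<Union>x\<in>S. \<Union> (annulus_cubes V \<alpha> (cube_at k x)))"

lemma annulus_trace_borel: "annulus_trace V \<alpha> S k \<in> sets borel"
proof -
  have "annulus_trace V \<alpha> S k = \<Union> (\<Union>x\<in>S. annulus_cubes V \<alpha> (cube_at k x))"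
    by (auto simp: annulus_trace_def)
  moreover have sub: "(\<Union>x\<in>S. annulus_cubes V \<alpha> (cube_at k x)) \<subseteq> dyadic_cubes"
    by (auto simp: annulus_cubes_def)
  moreover have "countable (\<Union>x\<in>S. annulus_cubes V \<alpha> (cube_at k x))"
    using countable_subset[OF sub countable_dyadic_cubes] .
  ultimately show ?thesis using dyadic_cubes_borel by (metis sets.countable_Union subset_iff)
qed

text \<open>
  On cubes with visible points the mass of the annulus cubes, which is the defect times the mass
  of the cube, is at most \<open>c\<close> times the integral of the defect over the part of \<open>F\<close> in the
  cube. Summed over all cubes and generations, this integral is
  bounded because the partial sums of the Dini function are.
\<close>

lemma sum_measure_annulus_trace_le:
  fixes V :: "(real ^ 'n::finite) set" and \<alpha> :: real and N :: nat and x0 :: "real ^ 'n"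
  assumes rad: "radon_measure \<mu>" and V: "subspace V"
  defines "F \<equiv> dini_bounded \<mu> V \<alpha> N x0"
  shows "(\<Sum>k<K. \<mu> (annulus_trace V \<alpha> (visible_points \<mu> F c) k)) \<le> ennreal c * (of_nat N * \<mu> F)"
proof -
  have om: "outer_measure_space UNIV \<mu>" using rad by (simp add: radon_measure_def)
  define S where "S = visible_points \<mu> F c"
  define M where "M = borel_restriction \<mu>"
  define \<Q> where "\<Q> k = cube_at k ` S" for k
  \<comment> \<open>the defect at generation \<open>k\<close>, restricted to \<open>F\<close> and to the cubes that contain visible points\<close>
  define h where "h k x = (\<Sum>Q\<in>\<Q> k. defect \<mu> Q V \<alpha> * indicator (F \<inter> Q) x)" for k x
  have SF: "S \<subseteq> F" by (auto simp: S_def visible_points_def)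
  have F0: "F \<subseteq> cube_at 0 x0" by (auto simp: F_def dini_bounded_def)
  have fin: "finite (\<Q> k)" for k
    by (rule finite_subset[OF _ finite_cubes_in_cube_at[of k 0 x0]]) (use SF F0 in \<open>auto simp: \<Q>_def\<close>)
  have F_borel: "F \<in> sets borel" unfolding F_def by (rule dini_bounded_borel)
  have FQ: "F \<inter> Q \<in> sets M" if "Q \<in> \<Q> k" for Q k
    using that F_borel cube_at_borel by (auto simp: M_def \<Q>_def)
  have meas: "h k \<in> borel_measurable M" for k
    unfolding h_def using FQ by (intro borel_measurable_sum borel_measurable_times_ennreal) auto
  have step: "\<mu> (annulus_trace V \<alpha> S k) \<le> ennreal c * (\<integral>\<^sup>+x. h k x \<partial>M)" for k
  proof -
    have "annulus_trace V \<alpha> S k = (\<Union>Q\<in>\<Q> k. \<Union> (annulus_cubes V \<alpha> Q))"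
      by (auto simp: annulus_trace_def \<Q>_def)
    then have "\<mu> (annulus_trace V \<alpha> S k) \<le> (\<Sum>Q\<in>\<Q> k. \<mu> (\<Union> (annulus_cubes V \<alpha> Q)))"
      using outer_measure_finite_UN_le[OF om fin] by metis
    also have "\<dots> \<le> (\<Sum>Q\<in>\<Q> k. ennreal c * (defect \<mu> Q V \<alpha> * \<mu> (F \<inter> Q)))"
    proof (rule sum_mono)
      fix Q assume "Q \<in> \<Q> k"
      then obtain x where x: "x \<in> S" "Q = cube_at k x" by (auto simp: \<Q>_def)
      then have vis: "\<mu> Q < ennreal c * \<mu> (F \<inter> Q)" by (auto simp: S_def visible_points_def)
      have "\<mu> (F \<inter> Q) \<le> \<mu> Q" by (rule outer_measure_mono[OF om]) auto
      then have pos: "\<mu> Q > 0" using vis by (metis gr_zeroI le_zero_eq mult_zero_right)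
      have "\<mu> (\<Union> (annulus_cubes V \<alpha> Q)) \<le> (\<Sum>R\<in>annulus_cubes V \<alpha> Q. \<mu> R)"
        using outer_measure_finite_UN_le[OF om finite_annulus_cubes[OF V], of Q "\<lambda>R. R" \<alpha>] x(2)
        by (simp add: cube_at_in_dyadic_cubes)
      also have "\<dots> = defect \<mu> Q V \<alpha> * \<mu> Q"
        using defect_times_measure[OF rad V] pos x(2) by simp
      also have "\<dots> \<le> defect \<mu> Q V \<alpha> * (ennreal c * \<mu> (F \<inter> Q))"
        using vis by (intro mult_left_mono) auto
      finally show "\<mu> (\<Union> (annulus_cubes V \<alpha> Q)) \<le> ennreal c * (defect \<mu> Q V \<alpha> * \<mu> (F \<inter> Q))"
        by (simp add: ac_simps)
    qed
    also have "\<dots> = ennreal c * (\<Sum>Q\<in>\<Q> k. defect \<mu> Q V \<alpha> * \<mu> (F \<inter> Q))"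
      by (simp add: sum_distrib_left)
    also have "(\<Sum>Q\<in>\<Q> k. defect \<mu> Q V \<alpha> * \<mu> (F \<inter> Q)) =
        (\<Sum>Q\<in>\<Q> k. \<integral>\<^sup>+x. defect \<mu> Q V \<alpha> * indicator (F \<inter> Q) x \<partial>M)"
    proof (rule sum.cong[OF refl])
      fix Q assume Q: "Q \<in> \<Q> k"
      have "emeasure M (F \<inter> Q) = \<mu> (F \<inter> Q)"
        using emeasure_borel_restriction[OF rad] FQ[OF Q] by (simp add: M_def)
      then show "defect \<mu> Q V \<alpha> * \<mu> (F \<inter> Q) = (\<integral>\<^sup>+x. defect \<mu> Q V \<alpha> * indicator (F \<inter> Q) x \<partial>M)"
        using nn_integral_cmult_indicator[OF FQ[OF Q]] by simp
    qed
    also have "\<dots> = (\<integral>\<^sup>+x. h k x \<partial>M)"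
      unfolding h_def using FQ by (intro nn_integral_sum[symmetric] borel_measurable_times_ennreal) auto
    finally show ?thesis .
  qed
  have h_le: "h k x \<le> defect \<mu> (cube_at k x) V \<alpha> * indicator F x" for k x
  proof -
    have "h k x \<le> (\<Sum>Q\<in>\<Q> k. if Q = cube_at k x then defect \<mu> (cube_at k x) V \<alpha> * indicator F x else 0)"
      unfolding h_def
    proof (rule sum_mono)
      fix Q assume Q: "Q \<in> \<Q> k"
      have "Q = cube_at k x" if "x \<in> Q"
        using Q that by (auto simp: \<Q>_def cube_at_eq)
      then show "defect \<mu> Q V \<alpha> * indicator (F \<inter> Q) x \<le>
          (if Q = cube_at k x then defect \<mu> (cube_at k x) V \<alpha> * indicator F x else 0)"
        by (cases "x \<in> Q"; cases "x \<in> F") simp_all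
    qed
    also have "\<dots> \<le> defect \<mu> (cube_at k x) V \<alpha> * indicator F x"
      using fin by (simp add: sum.delta)
    finally show ?thesis .
  qed
  have "(\<Sum>k<K. h k x) \<le> of_nat N * indicator F x" for x
  proof -
    have "(\<Sum>k<K. h k x) \<le> (\<Sum>k<K. defect \<mu> (cube_at k x) V \<alpha>) * indicator F x"
      unfolding sum_distrib_right by (intro sum_mono h_le)
    also have "\<dots> \<le> of_nat N * indicator F x"
      by (cases "x \<in> F") (auto simp: F_def dini_bounded_def)
    finally show ?thesis .
  qed
  then have "(\<integral>\<^sup>+x. (\<Sum>k<K. h k x) \<partial>M) \<le> (\<integral>\<^sup>+x. of_nat N * indicator F x \<partial>M)"
    by (intro nn_integral_mono)
  also have "\<dots> = of_nat N * \<mu> F"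
    using F_borel emeasure_borel_restriction[OF rad F_borel]
    by (subst nn_integral_cmult_indicator) (auto simp: M_def)
  finally have bound: "(\<Sum>k<K. \<integral>\<^sup>+x. h k x \<partial>M) \<le> of_nat N * \<mu> F"
    using meas by (simp add: nn_integral_sum)
  have "(\<Sum>k<K. \<mu> (annulus_trace V \<alpha> S k)) \<le> (\<Sum>k<K. ennreal c * (\<integral>\<^sup>+x. h k x \<partial>M))"
    by (intro sum_mono step)
  also have "\<dots> = ennreal c * (\<Sum>k<K. \<integral>\<^sup>+x. h k x \<partial>M)"
    by (simp add: sum_distrib_left)
  also have "\<dots> \<le> ennreal c * (of_nat N * \<mu> F)"
    by (intro mult_left_mono bound) simp
  finally show ?thesis by (simp add: S_def)
qed

text \<open>Borel-Cantelli, since the partial sums of the measures have a common bound.\<close>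

lemma limsup_annulus_trace_null:
  fixes V :: "(real ^ 'n::finite) set" and \<alpha> :: real and N :: nat and x0 :: "real ^ 'n"
  assumes rad: "radon_measure \<mu>" and V: "subspace V"
  defines "F \<equiv> dini_bounded \<mu> V \<alpha> N x0"
  shows "\<mu> (limsup (annulus_trace V \<alpha> (visible_points \<mu> F c))) = 0"
proof -
  define A where "A = annulus_trace V \<alpha> (visible_points \<mu> F c)"
  define M where "M = borel_restriction \<mu>"
  have A: "A k \<in> sets M" and eA: "emeasure M (A k) = \<mu> (A k)" for k
    by (simp_all add: A_def M_def annulus_trace_borel emeasure_borel_restriction[OF rad])
  have om: "outer_measure_space UNIV \<mu>" using rad by (simp add: radon_measure_def)
  have "\<mu> F \<le> \<mu> (cube_at 0 x0)"
    by (rule outer_measure_mono[OF om]) (auto simp: F_def dini_bounded_def)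
  also have "\<dots> < \<infinity>" by (rule radon_measure_bounded_finite[OF rad bounded_cube_at])
  finally have "ennreal c * (of_nat N * \<mu> F) < \<infinity>"
    by (simp add: ennreal_mult_less_top of_nat_less_top)
  then obtain T where T: "0 \<le> T" "ennreal c * (of_nat N * \<mu> F) = ennreal T"
    by (cases "ennreal c * (of_nat N * \<mu> F)" rule: ennreal_cases) auto
  have sum: "(\<Sum>k<K. emeasure M (A k)) \<le> ennreal T" for K
    using sum_measure_annulus_trace_le[OF rad V, of \<alpha> N x0 c K] T(2)
    unfolding eA unfolding A_def F_def by simp
  have finA: "emeasure M (A k) < \<infinity>" for k
  proof -
    have "emeasure M (A k) \<le> (\<Sum>j<Suc k. emeasure M (A j))" by simp
    also have "\<dots> \<le> ennreal T" by (rule sum)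
    also have "\<dots> < \<infinity>" by simp
    finally show ?thesis .
  qed
  have "summable (\<lambda>k. measure M (A k))"
  proof (rule summableI_nonneg_bounded)
    fix K
    have "ennreal (\<Sum>k<K. measure M (A k)) = (\<Sum>k<K. emeasure M (A k))"
      using finA by (simp add: emeasure_eq_ennreal_measure less_top flip: sum_ennreal)
    then have "ennreal (\<Sum>k<K. measure M (A k)) \<le> ennreal T"
      using sum[of K] by (rule ord_eq_le_trans)
    then show "(\<Sum>k<K. measure M (A k)) \<le> T"
      using T(1) by (simp only: ennreal_le_iff)
  qed simp
  then have "limsup A \<in> null_sets M"
    using A finA by (intro borel_cantelli_limsup1) auto
  then have "limsup A \<in> sets borel" "emeasure M (limsup A) = 0"
    by (simp_all add: null_sets_def M_def)
  then show ?thesis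
    using emeasure_borel_restriction[OF rad, of "limsup A"] by (simp add: M_def A_def)
qed

section \<open>Finite Dini function forces positive lower density\<close>

text \<open>
  A point \<open>x\<close> in the cone of a nearby point \<open>y\<close> of \<open>S\<close> lies in the annulus trace of \<open>S\<close> at some
  late generation. Nearby points of \<open>S\<close> that avoid all late traces thus avoid each other's
  cones. In a cube of generation \<open>k0\<close> they form a Lipschitz graph over \<open>V\<close>.
\<close>

lemma lower_density_zero_null_avoiding_traces:
  fixes V :: "(real ^ 'n::finite) set"
  assumes rad: "radon_measure \<mu>" and V: "subspace V" and \<alpha>: "\<alpha> > 0"
  shows "\<mu> {x \<in> S. (\<forall>k\<ge>k0. x \<notin> annulus_trace V \<alpha> S k) \<and> lower_density (dim V) \<mu> x = 0} = 0"
proof -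
  have om: "outer_measure_space UNIV \<mu>" using rad by (simp add: radon_measure_def)
  define P where "P Q = {x \<in> S \<inter> Q. \<forall>k\<ge>k0. x \<notin> annulus_trace V \<alpha> S k}" for Q
  obtain I :: "'n set" and \<psi> :: "real ^ 'n \<Rightarrow> real ^ 'n" and C :: real where \<psi>: "card I = dim V" "linear \<psi>" "\<And>x i. i \<notin> I \<Longrightarrow> \<psi> x $ i = 0"
    "\<And>x y. x - y \<notin> bad_cone V \<alpha> \<Longrightarrow> dist x y \<le> C * dist (\<psi> x) (\<psi> y)"
    using outside_bad_cone_coordinates[OF V \<alpha>] by metis
  have null: "\<mu> {x \<in> P (cube_at k0 z). lower_density (dim V) \<mu> x = 0} = 0" for z
    unfolding \<psi>(1)[symmetric]
  proof (rule lower_density_zero_null_on_graph[OF om])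
    show "\<psi> x $ i = 0" if "i \<notin> I" for x i using \<psi>(3)[OF that] .
    have "bounded (P (cube_at k0 z))"
      by (rule bounded_subset[OF bounded_cube_at[of k0 z]]) (auto simp: P_def)
    then show "bounded (\<psi> ` P (cube_at k0 z))"
      using \<psi>(2) by (simp add: bounded_linear_image linear_conv_bounded_linear)
    fix x y assume xy: "x \<in> P (cube_at k0 z)" "y \<in> P (cube_at k0 z)"
    show "dist x y \<le> C * dist (\<psi> x) (\<psi> y)"
    proof (rule \<psi>(4), rule notI)
      assume cone: "x - y \<in> bad_cone V \<alpha>"
      have "y \<in> cube_at k0 x" using xy by (auto simp: P_def mem_cube_at_iff)
      from cone_point_in_some_annulus[OF V \<alpha> cone dist_cube_at[OF this]]
      obtain k where "k \<ge> k0" "cube_at k x \<in> annulus_cubes V \<alpha> (cube_at k y)" by blast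
      moreover have "y \<in> S" using xy(2) by (simp add: P_def)
      ultimately have "x \<in> annulus_trace V \<alpha> S k"
        unfolding annulus_trace_def using cube_at_self[of x k] by blast
      then show False using xy(1) \<open>k \<ge> k0\<close> by (auto simp: P_def)
    qed
  qed
  have "\<mu> (\<Union>Q\<in>range (cube_at k0). {x \<in> P Q. lower_density (dim V) \<mu> x = 0}) = 0"
  proof (rule outer_null_countable_UN[OF om])
    show "countable (range (cube_at k0 :: real ^ 'n \<Rightarrow> _))"
      by (rule countable_subset[OF _ countable_dyadic_cubes]) (auto simp: cube_at_in_dyadic_cubes)
  qed (use null in auto)
  then show ?thesis
    by (rule outer_null_subset[OF om, rotated]) (auto simp: P_def intro: cube_at_self)
qed

lemma lower_density_zero_null_on_visible:
  fixes V :: "(real ^ 'n::finite) set" and \<alpha> :: real and N :: nat and x0 :: "real ^ 'n"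
  assumes rad: "radon_measure \<mu>" and V: "subspace V" and \<alpha>: "\<alpha> > 0"
  defines "F \<equiv> dini_bounded \<mu> V \<alpha> N x0"
  shows "\<mu> {x \<in> visible_points \<mu> F c. lower_density (dim V) \<mu> x = 0} = 0"
proof -
  have om: "outer_measure_space UNIV \<mu>" using rad by (simp add: radon_measure_def)
  define S where "S = visible_points \<mu> F c"
  define L where "L = limsup (annulus_trace V \<alpha> S)"
  define E where "E k0 = {x \<in> S. (\<forall>k\<ge>k0. x \<notin> annulus_trace V \<alpha> S k) \<and> lower_density (dim V) \<mu> x = 0}"
    for k0
  have L: "\<mu> L = 0"
    unfolding L_def S_def F_def by (rule limsup_annulus_trace_null[OF rad V])
  have E: "\<mu> (\<Union>k0. E k0) = 0"
    unfolding E_def by (intro outer_null_countable_UN[OF om] lower_density_zero_null_avoiding_traces rad V \<alpha>) auto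
  have "{x \<in> S. lower_density (dim V) \<mu> x = 0} \<subseteq> L \<union> (\<Union>k0. E k0)"
    by (auto simp: L_def E_def limsup_INF_SUP)
  then have "\<mu> {x \<in> S. lower_density (dim V) \<mu> x = 0} \<le> \<mu> (L \<union> (\<Union>k0. E k0))"
    by (rule outer_measure_mono[OF om])
  also have "\<dots> \<le> \<mu> L + \<mu> (\<Union>k0. E k0)" by (rule outer_measure_Un_le[OF om])
  finally show ?thesis using L E by (simp add: S_def)
qed

text \<open>
  The invisible points at level \<open>c\<close> have measure at most a constant over \<open>c\<close>, and \<open>c\<close> is
  arbitrary.
\<close>

lemma lower_density_zero_null_on_dini_bounded:
  fixes V :: "(real ^ 'n::finite) set" and \<alpha> :: real and N :: nat and x0 :: "real ^ 'n"
  assumes rad: "radon_measure \<mu>" and V: "subspace V" and \<alpha>: "\<alpha> > 0"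
  defines "F \<equiv> dini_bounded \<mu> V \<alpha> N x0"
  shows "\<mu> {x \<in> F. lower_density (dim V) \<mu> x = 0} = 0"
proof -
  have om: "outer_measure_space UNIV \<mu>" using rad by (simp add: radon_measure_def)
  define Z where "Z = {x \<in> F. lower_density (dim V) \<mu> x = 0}"
  obtain T where T: "0 \<le> T" "\<mu> (cube_at 0 x0) = ennreal T"
    using radon_measure_bounded_finite[OF rad bounded_cube_at, of 0 x0]
    by (cases "\<mu> (cube_at 0 x0)" rule: ennreal_cases) auto
  have F0: "F \<subseteq> cube_at 0 x0" by (auto simp: F_def dini_bounded_def)
  have key: "\<mu> Z \<le> ennreal (T / c)" if c: "c > 0" for c
  proof -
    have "\<mu> Z \<le> \<mu> ({x \<in> visible_points \<mu> F c. lower_density (dim V) \<mu> x = 0} \<union> (F - visible_points \<mu> F c))"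
      by (rule outer_measure_mono[OF om]) (auto simp: Z_def)
    also have "\<dots> \<le> \<mu> {x \<in> visible_points \<mu> F c. lower_density (dim V) \<mu> x = 0}
        + \<mu> (F - visible_points \<mu> F c)"
      by (rule outer_measure_Un_le[OF om])
    also have "\<dots> = \<mu> (F - visible_points \<mu> F c)"
      using lower_density_zero_null_on_visible[OF rad V \<alpha>] by (simp add: F_def)
    also have "\<dots> \<le> ennreal (1 / c) * \<mu> (cube_at 0 x0)"
      by (rule measure_invisible_points[OF rad F0 c])
    also have "\<dots> = ennreal (T / c)"
      using c T by (simp flip: ennreal_mult)
    finally show ?thesis .
  qed
  have "\<mu> Z \<le> 0"
  proof (rule ennreal_le_epsilon)
    fix e :: real assume e: "0 < e"
    have "T / ((T + 1) / e) \<le> e" using e T(1) by (simp add: field_simps)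
    then show "\<mu> Z \<le> 0 + ennreal e"
      using key[of "(T + 1) / e"] e T(1) by (simp del: divide_divide_eq_right) (meson ennreal_leI order_trans)
  qed
  then show ?thesis by (simp add: Z_def)
qed

lemma lower_density_zero_null_one_cone:
  fixes V :: "(real ^ 'n::finite) set"
  assumes rad: "radon_measure \<mu>" and V: "subspace V" and \<alpha>: "\<alpha> > 0"
  shows "\<mu> {x. conical_dini \<mu> V \<alpha> x < \<infinity> \<and> lower_density (dim V) \<mu> x = 0} = 0"
proof -
  have om: "outer_measure_space UNIV \<mu>" using rad by (simp add: radon_measure_def)
  define F where "F N Q = {x \<in> Q. \<forall>K. (\<Sum>k<K. defect \<mu> (cube_at k x) V \<alpha>) \<le> of_nat N}" for N :: nat and Q
  define U where "U = (\<Union>(N, Q) \<in> UNIV \<times> range (cube_at 0). {x \<in> F N Q. lower_density (dim V) \<mu> x = 0})"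
  have "\<mu> U = 0"
    unfolding U_def
  proof (rule outer_null_countable_UN[OF om])
    have "countable (range (cube_at 0 :: real ^ 'n \<Rightarrow> _))"
      by (rule countable_subset[OF _ countable_dyadic_cubes]) (auto simp: cube_at_in_dyadic_cubes)
    then show "countable ((UNIV :: nat set) \<times> range (cube_at 0 :: real ^ 'n \<Rightarrow> _))" by simp
    fix i assume "i \<in> (UNIV :: nat set) \<times> range (cube_at 0 :: real ^ 'n \<Rightarrow> _)"
    then obtain N and x0 :: "real ^ 'n" where "i = (N, cube_at 0 x0)" by auto
    then show "\<mu> (case i of (N, Q) \<Rightarrow> {x \<in> F N Q. lower_density (dim V) \<mu> x = 0}) = 0"
      using lower_density_zero_null_on_dini_bounded[OF rad V \<alpha>, of N x0]
      by (simp add: F_def dini_bounded_def)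
  qed
  moreover have "{x. conical_dini \<mu> V \<alpha> x < \<infinity> \<and> lower_density (dim V) \<mu> x = 0} \<subseteq> U"
  proof
    fix x assume x: "x \<in> {x. conical_dini \<mu> V \<alpha> x < \<infinity> \<and> lower_density (dim V) \<mu> x = 0}"
    then obtain N :: nat where "conical_dini \<mu> V \<alpha> x < of_nat N"
      using ennreal_Ex_less_of_nat by (auto simp: less_top)
    then have "x \<in> F N (cube_at 0 x)"
      using sum_defect_le_conical_dini[of \<mu> x V \<alpha>] by (auto simp: F_def intro: order_trans less_imp_le)
    then show "x \<in> U" using x by (auto simp: U_def)
  qed
  ultimately show ?thesis by (rule outer_null_subset[OF om, rotated])
qed

text \<open>
  The exceptional null set of a single cone may depend on the cone. Choosing one
  representative cone for each of the countably many index patterns keeps the union null.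
\<close>

lemma lower_density_zero_null_all_cones:
  fixes \<mu> :: "(real ^ 'n::finite) set \<Rightarrow> ennreal"
  assumes rad: "radon_measure \<mu>"
  shows "\<mu> {x. (\<exists>V \<alpha>. V \<in> grassmannian m \<and> 0 < \<alpha> \<and> conical_dini \<mu> V \<alpha> x < \<infinity>)
              \<and> lower_density m \<mu> x = 0} = 0" (is "\<mu> ?Z = 0")
proof -
  have om: "outer_measure_space UNIV \<mu>" using rad by (simp add: radon_measure_def)
  define cones where "cones = {(V :: (real ^ 'n) set, \<alpha> :: real). V \<in> grassmannian m \<and> 0 < \<alpha>}"
  \<comment> \<open>the patterns of annulus cubes that occur, and a cone realizing each\<close>
  define \<Lambda> where "\<Lambda> = (\<lambda>(V, \<alpha>). annulus_indices V \<alpha>) ` cones"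
  define rep where "rep = inv_into cones (\<lambda>(V, \<alpha>). annulus_indices V \<alpha>)"
  define E where "E p = {x. conical_dini \<mu> (fst p) (snd p) x < \<infinity> \<and> lower_density m \<mu> x = 0}" for p
  have "countable \<Lambda>"
  proof (rule countable_subset)
    show "\<Lambda> \<subseteq> Collect finite" using finite_annulus_indices by (auto simp: \<Lambda>_def)
  qed (rule countable_Collect_finite)
  have null: "\<mu> (E p) = 0" if "p \<in> cones" for p
    using that lower_density_zero_null_one_cone[OF rad, of "fst p" "snd p"]
    by (auto simp: cones_def E_def grassmannian_def)
  have "\<mu> (\<Union>L\<in>\<Lambda>. E (rep L)) = 0"
    using \<open>countable \<Lambda>\<close> null unfolding \<Lambda>_def rep_def
    by (intro outer_null_countable_UN[OF om]) (auto intro!: null inv_into_into)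
  moreover have "?Z \<subseteq> (\<Union>L\<in>\<Lambda>. E (rep L))"
  proof
    fix x assume "x \<in> ?Z"
    then obtain V \<alpha> where V: "(V, \<alpha>) \<in> cones" "conical_dini \<mu> V \<alpha> x < \<infinity>" "lower_density m \<mu> x = 0"
      by (auto simp: cones_def)
    define L where "L = annulus_indices V \<alpha>"
    have L: "L \<in> \<Lambda>" using V(1) by (force simp: \<Lambda>_def L_def)
    have "rep L \<in> cones" "annulus_indices (fst (rep L)) (snd (rep L)) = L"
      using L inv_into_into[of L "\<lambda>(V, \<alpha>). annulus_indices V \<alpha>" cones]
        f_inv_into_f[of L "\<lambda>(V, \<alpha>). annulus_indices V \<alpha>" cones]
      by (auto simp: rep_def \<Lambda>_def case_prod_beta)
    then have "conical_dini \<mu> (fst (rep L)) (snd (rep L)) = conical_dini \<mu> V \<alpha>"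
      using V(1) by (intro conical_dini_cong) (auto simp: cones_def grassmannian_def L_def)
    then have "x \<in> E (rep L)" using V by (simp add: E_def)
    then show "x \<in> (\<Union>L\<in>\<Lambda>. E (rep L))" using L by blast
  qed
  ultimately show ?thesis by (rule outer_null_subset[OF om, rotated])
qed

theorem corollary1p8:
  fixes \<mu> :: "(real ^ 'n::finite) set \<Rightarrow> ennreal" and m :: nat
  assumes "1 \<le> m" and "m \<le> CARD('n) - 1"
    and "radon_measure \<mu>"
  shows "outer_AE \<mu> (\<lambda>x.
           (\<exists>V \<alpha>. V \<in> grassmannian m \<and> 0 < \<alpha> \<and> conical_dini \<mu> V \<alpha> x < \<infinity>)
           \<longrightarrow> lower_density m \<mu> x > 0)
       \<and> outer_AE \<mu> (\<lambda>x.
           lower_density m \<mu> x = 0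
           \<longrightarrow> (\<forall>V \<alpha>. V \<in> grassmannian m \<and> 0 < \<alpha> \<longrightarrow> conical_dini \<mu> V \<alpha> x = \<infinity>))"
proof -
  let ?Z = "{x. (\<exists>V \<alpha>. V \<in> grassmannian m \<and> 0 < \<alpha> \<and> conical_dini \<mu> V \<alpha> x < \<infinity>)
                \<and> lower_density m \<mu> x = 0}"
  have "{x. \<not> ((\<exists>V \<alpha>. V \<in> grassmannian m \<and> 0 < \<alpha> \<and> conical_dini \<mu> V \<alpha> x < \<infinity>)
           \<longrightarrow> lower_density m \<mu> x > 0)} = ?Z"
    by (simp only: not_gr_zero not_imp)
  moreover have "{x. \<not> (lower_density m \<mu> x = 0
           \<longrightarrow> (\<forall>V \<alpha>. V \<in> grassmannian m \<and> 0 < \<alpha> \<longrightarrow> conical_dini \<mu> V \<alpha> x = \<infinity>))} = ?Z"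
    by (auto simp: less_top)
  ultimately show ?thesis
    unfolding outer_AE_def using lower_density_zero_null_all_cones[OF assms(3), of m] by simp
qed

end
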